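(* Let $A,B$ be two Lebesgue measurable sets in $\mathbb{R}^d$. Then all partial Hilbert transforms $H_j$, $1\le j\le d$, satisfy the Bedrosian identity with respect to $(A,B)$ if and only if there exist constants $0\le a_j,b_j\le+\infty$, $1\le j\le d$, such that $$\tilde A\subseteq\prod_{j=1}^d[-a_j,b_j],\qquad \tilde B\subseteq\prod_{j=1}^d\bigl(\mathbb{R}\setminus(-b_j,a_j)\bigr).$$
   Context: Functions are complex-valued. The Fourier transform is $\hat f(\xi)=(2\pi)^{-d/2}\int_{\mathbb{R}^d}f(x)e^{-ix\cdot\xi}\,dx$ for $f\in L^1(\mathbb{R}^d)$, extended to $L^2(\mathbb{R}^d)$ in the usual way. Lebesgue measure is denoted $|\cdot|$. For a Lebesgue measurable set $E\subseteq\mathbb{R}^d$, $\tilde E$ denotes the set of all points $x_0\in\mathbb{R}^d$ such that $|U\cap E|>0$ for every open neighborhood $U$ of $x_0$. The support $\operatorname{supp}\varphi$ of a Lebesgue measurable function $\varphi$ on $\mathbb{R}^d$ is $\tilde E$ with $E=\{x:\varphi(x)\neq0\}$. The partial Hilbert transforms $H_j$, $1\le j\le d$, are the bounded linear operators on $L^2(\mathbb{R}^d)$ defined by $(H_jf)\hat{\,}(\xi):=-i\,\operatorname{sgn}(\xi_j)\hat f(\xi)$, where $\operatorname{sgn}(t)$ is $-1,0,1$ for $t<0$, $t=0$, $t>0$ respectively. Bedrosian identity: a bounded linear operator $T:L^2(\mathbb{R}^d)\to L^2(\mathbb{R}^d)$ satisfies the Bedrosian identity with respect to a pair $(A,B)$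 of Lebesgue measurable sets $A,B\subseteq\mathbb{R}^d$ if $T(fg)=f\,(Tg)$ holds for all $f,g\in L^2(\mathbb{R}^d)\cap L^\infty(\mathbb{R}^d)$ with $\operatorname{supp}\hat f\subseteq A$ and $\operatorname{supp}\hat g\subseteq B$. Intervals are understood as subsets of $\mathbb{R}$: $[-a_j,b_j]$ means $\{t\in\mathbb{R}:-a_j\le t\le b_j\}$ and $(-b_j,a_j)$ means $\{t\in\mathbb{R}:-b_j<t<a_j\}$, also when $a_j$ or $b_j$ equals $+\infty$. *)

theory Defs
  imports "HOL-Analysis.Analysis"
begin

text \<open>
  Elements of the spaces $L^p$ are represented by Lebesgue measurable functions; equality of
  elements is equality almost everywhere, and operators act on representatives.
\<close>

definition L1 :: "(real^'n \<Rightarrow> complex) set" where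
  "L1 = {f. integrable lebesgue f}"

definition L2 :: "(real^'n \<Rightarrow> complex) set" where
  "L2 = {f. f \<in> borel_measurable lebesgue \<and> integrable lebesgue (\<lambda>x. (norm (f x))\<^sup>2)}"

definition Linf :: "(real^'n \<Rightarrow> complex) set" where
  "Linf = {f. f \<in> borel_measurable lebesgue \<and> (\<exists>C::real. AE x in lebesgue. norm (f x) \<le> C)}"

text \<open>
  The squared distance is a nonnegative extended integral, so that it is infinite (and not
  the default value 0 of the Bochner integral) when the difference is not square integrable.
\<close>

definition L2_tendsto :: "(nat \<Rightarrow> real^'n \<Rightarrow> complex) \<Rightarrow> (real^'n \<Rightarrow> complex) \<Rightarrow> bool" where
  "L2_tendsto F f \<longleftrightarrow>
     (\<lambda>k. \<integral>\<^sup>+ x. ennreal ((norm (F k x - f x))\<^sup>2) \<partial>lebesgue) \<longlonglongrightarrow> 0"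

definition fourier_L1 :: "(real^'n \<Rightarrow> complex) \<Rightarrow> real^'n \<Rightarrow> complex" where
  "fourier_L1 f \<xi> =
     of_real ((2 * pi) powr (- real CARD('n) / 2)) *
     (LINT x|lebesgue. f x * exp (- \<i> * of_real (x \<bullet> \<xi>)))"

text \<open>
  The extension to $L^2$ by continuity. By Plancherel's theorem a function \<open>g\<close> as below exists
  for every \<open>f\<close> in $L^2$, and it is unique up to null sets; \<open>fourier_L2 f\<close> is some
  representative of it.
\<close>

definition is_fourier_L2 :: "(real^'n \<Rightarrow> complex) \<Rightarrow> (real^'n \<Rightarrow> complex) \<Rightarrow> bool" where
  "is_fourier_L2 f g \<longleftrightarrow> f \<in> L2 \<and> g \<in> L2 \<and>
     (\<exists>F. (\<forall>k. F k \<in> L1 \<inter> L2) \<and> L2_tendsto F f \<and> L2_tendsto (\<lambda>k. fourier_L1 (F k)) g)"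

definition fourier_L2 :: "(real^'n \<Rightarrow> complex) \<Rightarrow> real^'n \<Rightarrow> complex" where
  "fourier_L2 f = (SOME g. is_fourier_L2 f g)"

text \<open>The set written $\tilde E$ for a Lebesgue measurable set $E$.\<close>

definition ess_closure :: "(real^'n) set \<Rightarrow> (real^'n) set" where
  "ess_closure E = {x0. \<forall>U. open U \<and> x0 \<in> U \<longrightarrow> emeasure lebesgue (U \<inter> E) > 0}"

definition supp :: "(real^'n \<Rightarrow> complex) \<Rightarrow> (real^'n) set" where
  "supp \<phi> = ess_closure {x. \<phi> x \<noteq> 0}"

text \<open>
  The element of $L^2$ with the prescribed Fourier transform exists and is unique up to null
  sets since the Fourier transform is a bijection of $L^2$; again a representative is chosen.
\<close>

definition partial_hilbert :: "'n \<Rightarrow> (real^'n \<Rightarrow> complex) \<Rightarrow> real^'n \<Rightarrow> complex" where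
  "partial_hilbert j f = (SOME h. h \<in> L2 \<and>
     (AE \<xi> in lebesgue. fourier_L2 h \<xi> = - \<i> * of_real (sgn (\<xi> $ j)) * fourier_L2 f \<xi>))"

text \<open>
  The notion is meant for (representatives of) bounded linear operators \<open>T\<close> on $L^2$.
\<close>

definition bedrosian_identity ::
    "((real^'n \<Rightarrow> complex) \<Rightarrow> real^'n \<Rightarrow> complex) \<Rightarrow> (real^'n) set \<Rightarrow> (real^'n) set \<Rightarrow> bool" where
  "bedrosian_identity T A B \<longleftrightarrow>
     (\<forall>f \<in> L2 \<inter> Linf. \<forall>g \<in> L2 \<inter> Linf.
        supp (fourier_L2 f) \<subseteq> A \<longrightarrow> supp (fourier_L2 g) \<subseteq> B \<longrightarrow>
        (AE x in lebesgue. T (\<lambda>y. f y * g y) x = f x * T g x))"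

end

theory Submission
  imports Defs "HOL-Probability.Characteristic_Functions"
begin

text \<open>
  For \<open>f\<close>, \<open>g\<close> square integrable the Fourier transform of \<open>f g\<close> is, up to a constant, the convolution
  of the transforms \<open>f'\<close> and \<open>g'\<close>. Hence \<open>H\<^sub>j (f g) = f H\<^sub>j g\<close> says that for almost every \<open>\<xi>\<close> the
  integral of \<open>f' \<eta> * g' (\<xi> - \<eta>) * (sgn \<xi>\<^sub>j - sgn (\<xi> - \<eta>)\<^sub>j)\<close> over \<open>\<eta>\<close> vanishes. If \<open>p + q\<close> and \<open>q\<close>
  have \<open>j\<close>-th components of the same sign for all \<open>p\<close> in the essential closure of \<open>A\<close> and \<open>q\<close> in that
  of \<open>B\<close> for which both components are nonzero, then the integrand vanishes. If the signs are opposite for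
  some \<open>p\<close>, \<open>q\<close>, then the indicators of small compact sets of positive measure near \<open>p\<close> and \<open>q\<close>, taken
  as \<open>f'\<close> and \<open>g'\<close>, violate the identity, since their convolution is nonnegative with positive integral.
  The sign condition is equivalent to the existence of \<open>a\<^sub>j\<close>, \<open>b\<^sub>j\<close>: take the suprema of 0 and of
  \<open>- p\<^sub>j\<close>, respectively \<open>p\<^sub>j\<close>, over the essential closure of \<open>A\<close>.

  Plancherel's theorem for \<open>f\<close> in \<open>L\<^sup>1\<close> and \<open>L\<^sup>2\<close> is obtained by damping the integral of the squared
  modulus of the transform with a Gaussian of width \<open>1 / s\<close>: Fubini's theorem turns it into a Gaussian
  average of the autocorrelation of \<open>f\<close> over translations of size \<open>s\<close>, which tends to the squared norm
  of \<open>f\<close> as \<open>s\<close> tends to 0.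
\<close>

section \<open>Integrals of Gaussians and continuity of translations\<close>

lemma lborel_integral_affine:
  fixes f :: "'a::euclidean_space \<Rightarrow> 'b::{banach,second_countable_topology}"
  assumes [measurable]: "f \<in> borel_measurable borel" and c: "c > 0"
  shows "(LINT x|lborel. f x) = c ^ DIM('a) *\<^sub>R (LINT x|lborel. f (t + c *\<^sub>R x))"
proof -
  have "(LINT x|lborel. f x) =
      (LINT x|density (distr lborel borel (\<lambda>x. t + c *\<^sub>R x)) (\<lambda>_. ennreal (\<bar>c\<bar> ^ DIM('a))). f x)"
    using c by (subst lborel_affine[of c t]) auto
  also have "\<dots> = c ^ DIM('a) *\<^sub>R (LINT x|lborel. f (t + c *\<^sub>R x))"
    using c by (subst integral_density) (auto simp: integral_distr)
  finally show ?thesis .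
qed

lemma distr_lborel_translate:
  "distr lborel borel (\<lambda>x. x - h) = (lborel :: 'a::euclidean_space measure)"
  using lborel_distr_plus[of "-h"] by (simp add: fun_eq_iff cong: distr_cong)

lemma
  fixes f :: "'a::euclidean_space \<Rightarrow> 'b::{banach,second_countable_topology}"
  assumes [measurable]: "f \<in> borel_measurable borel"
  shows lborel_integral_translate: "(LINT x|lborel. f (x - h)) = (LINT x|lborel. f x)"
    and lborel_integrable_translate: "integrable lborel (\<lambda>x. f (x - h)) \<longleftrightarrow> integrable lborel f"
proof -
  have m: "(\<lambda>x. x - h) \<in> lborel \<rightarrow>\<^sub>M borel" by simp
  show "(LINT x|lborel. f (x - h)) = (LINT x|lborel. f x)"
    using integral_distr[OF m assms] by (simp add: distr_lborel_translate)
  show "integrable lborel (\<lambda>x. f (x - h)) \<longleftrightarrow> integrable lborel f"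
    using integrable_distr_eq[OF m assms] by (simp add: distr_lborel_translate)
qed

section \<open>Fourier integrals of Gaussians\<close>

text \<open>Up to the factor \<open>sqrt (2 * pi)\<close> the integral is the characteristic
  function of the standard normal distribution, whose value is known.\<close>

lemma integral_gaussian_iexp_real:
  "integrable lborel (\<lambda>t. complex_of_real (exp (- t\<^sup>2 / 2)) * iexp (s * t))" (is ?int)
  "(LINT t|lborel. complex_of_real (exp (- t\<^sup>2 / 2)) * iexp (s * t)) = 
     complex_of_real (sqrt (2 * pi) * exp (- s\<^sup>2 / 2))" (is ?eq)
proof -
  have i0: "integrable lborel (\<lambda>t. std_normal_density t)" by simp
  have "integrable lborel (\<lambda>t. sqrt (2 * pi) * std_normal_density t)"
    using i0 by simp
  then have "integrable lborel (\<lambda>t. exp (- t\<^sup>2 / 2) :: real)"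
    by (simp add: std_normal_density_def)
  then show ?int
    by (rule Bochner_Integration.integrable_bound) (auto simp: norm_mult)
  have "complex_of_real (exp (- s\<^sup>2 / 2)) = char std_normal_distribution s"
    by (simp add: char_std_normal_distribution)
  also have "\<dots> = (LINT t|lborel. std_normal_density t *\<^sub>R iexp (s * t))"
    unfolding char_def by (subst integral_density) (auto simp: normal_density_nonneg)
  also have "\<dots> = (LINT t|lborel. complex_of_real (1 / sqrt (2 * pi)) * (complex_of_real (exp (- t\<^sup>2 / 2)) * iexp (s * t)))"
    by (simp add: std_normal_density_def scaleR_conv_of_real mult_ac)
  also have "\<dots> = complex_of_real (1 / sqrt (2 * pi)) * (LINT t|lborel. complex_of_real (exp (- t\<^sup>2 / 2)) * iexp (s * t))"
    by (rule integral_mult_right_zero)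
  finally have eq: "complex_of_real (exp (- s\<^sup>2 / 2)) = complex_of_real (1 / sqrt (2 * pi)) * (LINT t|lborel. complex_of_real (exp (- t\<^sup>2 / 2)) * iexp (s * t))" .
  have "complex_of_real (sqrt (2 * pi) * exp (- s\<^sup>2 / 2)) = 
     complex_of_real (sqrt (2 * pi)) * complex_of_real (exp (- s\<^sup>2 / 2))" by simp
  also have "\<dots> = complex_of_real (sqrt (2 * pi)) * (complex_of_real (1 / sqrt (2 * pi)) * (LINT t|lborel. complex_of_real (exp (- t\<^sup>2 / 2)) * iexp (s * t)))"
    by (simp only: eq)
  also have "\<dots> = (LINT t|lborel. complex_of_real (exp (- t\<^sup>2 / 2)) * iexp (s * t))"
    by (simp add: mult.assoc[symmetric] of_real_mult[symmetric] del: of_real_mult)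
  finally show ?eq by simp
qed

text \<open>Lebesgue measure on a Euclidean space is the image of the product, over the basis, of
  the one-dimensional Lebesgue measures, so Fubini's theorem for finite products applies.\<close>

lemma
  fixes f :: "'a::euclidean_space \<Rightarrow> real \<Rightarrow> complex"
  assumes "\<And>b. b \<in> Basis \<Longrightarrow> integrable lborel (f b)"
  shows lborel_integral_prod_Basis: 
    "(LINT x|lborel. (\<Prod>b\<in>Basis. f b (x \<bullet> b))) = (\<Prod>b\<in>Basis. (LINT t|lborel. f b t))" (is ?eq)
    and lborel_integrable_prod_Basis: "integrable lborel (\<lambda>x. \<Prod>b\<in>Basis. f b (x \<bullet> b))" (is ?int)
proof -
  interpret product_sigma_finite "\<lambda>_::'a. lborel :: real measure" ..
  have [measurable]: "\<And>b. b \<in> Basis \<Longrightarrow> f b \<in> borel_measurable borel"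
    using borel_measurable_integrable[OF assms] by simp
  have m: "(\<lambda>g. \<Sum>b\<in>Basis. g b *\<^sub>R b) \<in> Pi\<^sub>M Basis (\<lambda>_::'a. lborel :: real measure) \<rightarrow>\<^sub>M borel"
    by simp
  have p: "(\<lambda>x::'a. \<Prod>b\<in>Basis. f b (x \<bullet> b)) \<in> borel_measurable borel"
    by measurable
  have s: "(\<Prod>b\<in>Basis. f b ((\<Sum>b\<in>Basis. g b *\<^sub>R b) \<bullet> b)) = (\<Prod>b\<in>Basis. f b (g b))" for g :: "'a \<Rightarrow> real"
    by (intro prod.cong) simp_all
  show ?eq
    by (subst lborel_eq, subst integral_distr[OF m p]) (simp add: s product_integral_prod assms)
  show ?int
    by (subst lborel_eq, subst integrable_distr_eq[OF m p]) (simp add: s product_integrable_prod assms)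
qed

text \<open>The squared norm and the inner product are sums over the basis, so the integrand is a
  product of one-dimensional integrands.\<close>

lemma
  fixes z :: "'a::euclidean_space"
  shows integrable_gaussian_iexp: 
     "integrable lborel (\<lambda>x. complex_of_real (exp (- (norm x)\<^sup>2 / 2)) * exp (- \<i> * of_real (x \<bullet> z)))" (is ?int)
   and integral_gaussian_iexp:
     "(LINT x|lborel. complex_of_real (exp (- (norm x)\<^sup>2 / 2)) * exp (- \<i> * of_real (x \<bullet> z))) = 
     complex_of_real (sqrt (2 * pi) ^ DIM('a) * exp (- (norm z)\<^sup>2 / 2))" (is ?eq)
proof -
  let ?f = "\<lambda>b t. complex_of_real (exp (- t\<^sup>2 / 2)) * iexp (- (z \<bullet> b) * t)"
  have n2: "(norm x)\<^sup>2 = (\<Sum>b\<in>Basis. (x \<bullet> b)\<^sup>2)" for x :: 'a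
    by (simp only: power2_norm_eq_inner) (subst euclidean_inner, simp add: power2_eq_square)
  have e: "complex_of_real (exp (- (norm x)\<^sup>2 / 2)) * exp (- \<i> * of_real (x \<bullet> z)) = 
     (\<Prod>b\<in>Basis. ?f b (x \<bullet> b))" for x :: 'a
  proof -
    have "(\<Prod>b\<in>Basis. ?f b (x \<bullet> b)) = 
       exp (\<Sum>b\<in>Basis. complex_of_real (- (x \<bullet> b)\<^sup>2 / 2)) * exp (\<Sum>b\<in>Basis. \<i> * of_real (- (z \<bullet> b) * (x \<bullet> b)))"
      by (simp add: prod.distrib exp_sum exp_of_real[symmetric])
    also have "(\<Sum>b\<in>Basis. complex_of_real (- (x \<bullet> b)\<^sup>2 / 2)) = complex_of_real (- (norm x)\<^sup>2 / 2)"
      by (simp add: n2 sum_negf sum_divide_distrib)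
    also have "(\<Sum>b\<in>Basis. \<i> * of_real (- (z \<bullet> b) * (x \<bullet> b))) = - \<i> * complex_of_real (x \<bullet> z)"
      by (subst euclidean_inner) (simp add: sum_negf sum_distrib_left[symmetric] mult_ac)
    finally show ?thesis by (simp add: exp_of_real[symmetric])
  qed
  show ?int
    unfolding e by (intro lborel_integrable_prod_Basis integral_gaussian_iexp_real)
  show ?eq
    unfolding e
    apply (subst lborel_integral_prod_Basis)
     apply (rule integral_gaussian_iexp_real)
    apply (simp only: integral_gaussian_iexp_real n2)
    by (simp add: prod.distrib exp_of_real[symmetric] exp_sum[symmetric] sum_negf sum_divide_distrib)
qed

section \<open>Continuity of translations in L1 and L2\<close>

text \<open>
  For an open set \<open>U\<close> the positive part of \<open>indicator U x - indicator U (x - h m)\<close> tends to 0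
  by dominated convergence, and by translation invariance it has the same integral as the negative
  part (Scheffe's argument). A general set is approximated from outside by open sets.
\<close>

lemma L1_translation_indicator:
  fixes A :: "'a::euclidean_space set" and h :: "nat \<Rightarrow> 'a"
  assumes A[measurable]: "A \<in> sets borel" and fin: "emeasure lborel A < \<infinity>" and h: "h \<longlonglongrightarrow> 0"
  shows "(\<lambda>m. LINT x|lborel. \<bar>indicator A (x - h m) - indicator A x\<bar> :: real) \<longlonglongrightarrow> 0"
proof (rule LIMSEQ_I)
  fix e :: real assume e: "e > 0"
  \<comment> \<open>Replacing \<open>A\<close> by \<open>U\<close> costs at most \<open>e/4\<close>
    at the point \<open>x\<close> and again at the translated point, which leaves \<open>e/2\<close>
    for \<open>U\<close> itself.\<close>
  obtain U where U: "open U" "A \<subseteq> U" "emeasure lborel (U - A) < e/4"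
    using outer_regular_lborel[OF A, of "e/4"] e by auto
  have [measurable]: "U \<in> sets borel" using U by auto
  have "emeasure lborel U = emeasure lborel A + emeasure lborel (U - A)"
    using U(2) by (subst plus_emeasure) (auto intro!: arg_cong[where f="emeasure lborel"])
  also have "\<dots> < \<infinity>" using fin U(3) by (auto simp: ennreal_add_eq_top less_top[symmetric])
  finally have finU: "emeasure lborel U < \<infinity>" .
  define u where "u = (indicator U :: 'a \<Rightarrow> real)"
  define a where "a = (indicator A :: 'a \<Rightarrow> real)"
  have [measurable]: "u \<in> borel_measurable borel" "a \<in> borel_measurable borel"
    unfolding u_def a_def by auto
  have iu: "integrable lborel u" unfolding u_def using finU by (simp add: integrable_indicator_iff)
  have ia: "integrable lborel a" unfolding a_def using fin by (simp add: integrable_indicator_iff)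
  have iut: "integrable lborel (\<lambda>x. u (x - k))" and iat: "integrable lborel (\<lambda>x. a (x - k))" for k
    using iu ia by (simp_all add: lborel_integrable_translate)
  have ua: "(LINT x|lborel. \<bar>u x - a x\<bar>) \<le> e/4"
  proof -
    have "(LINT x|lborel. \<bar>u x - a x\<bar>) = (LINT x|lborel. indicator (U - A) x)"
      using U(2) by (intro Bochner_Integration.integral_cong) (auto simp: u_def a_def indicator_def)
    also have "\<dots> = measure lborel (U - A)" by simp
    also have "\<dots> \<le> e/4"
      unfolding measure_def using U(3) e by (intro enn2real_leI) auto
    finally show ?thesis .
  qed
  have uat: "(LINT x|lborel. \<bar>u (x - k) - a (x - k)\<bar>) \<le> e/4" for k
    using ua by (subst lborel_integral_translate[where f="\<lambda>x. \<bar>u x - a x\<bar>"]) simp_all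
  have lim: "(\<lambda>m. LINT x|lborel. max 0 (u x - u (x - h m))) \<longlonglongrightarrow> (LINT x::'a|lborel. 0)"
  proof (rule integral_dominated_convergence[where w=u])
    show "AE x in lborel. (\<lambda>m. max 0 (u x - u (x - h m))) \<longlonglongrightarrow> 0"
    proof (rule AE_I2)
      fix x
      have "\<forall>\<^sub>F m in sequentially. max 0 (u x - u (x - h m)) = 0"
      proof (cases "x \<in> U")
        case True
        have "(\<lambda>m. x - h m) \<longlonglongrightarrow> x - 0" by (intro tendsto_intros h)
        then have "\<forall>\<^sub>F m in sequentially. x - h m \<in> U"
          using U(1) True by (auto simp: tendsto_def)
        then show ?thesis by eventually_elim (simp add: u_def True)
      qed (simp add: u_def)
      then show "(\<lambda>m. max 0 (u x - u (x - h m))) \<longlonglongrightarrow> 0" by (rule tendsto_eventually)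
    qed
  qed (use iu in \<open>auto simp: u_def split: split_indicator\<close>)
  have eqU: "(LINT x|lborel. \<bar>u (x - k) - u x\<bar>) = 2 * (LINT x|lborel. max 0 (u x - u (x - k)))" for k
  proof -
    have "(LINT x|lborel. \<bar>u (x - k) - u x\<bar>) = (LINT x|lborel. 2 * max 0 (u x - u (x - k)) + (u (x - k) - u x))"
      by (intro Bochner_Integration.integral_cong) (auto simp: max_def abs_if)
    also have "\<dots> = 2 * (LINT x|lborel. max 0 (u x - u (x - k))) + ((LINT x|lborel. u (x - k)) - (LINT x|lborel. u x))"
      using iu iut by (subst Bochner_Integration.integral_add) auto
    finally show ?thesis by (simp add: lborel_integral_translate)
  qed
  have "(\<lambda>m. LINT x|lborel. \<bar>u (x - h m) - u x\<bar>) \<longlonglongrightarrow> 0"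
    unfolding eqU using tendsto_mult_right_zero[of _ sequentially 2] lim by simp
  then obtain N where N: "\<And>m. m \<ge> N \<Longrightarrow> norm ((LINT x|lborel. \<bar>u (x - h m) - u x\<bar>) - 0) < e/2"
    using LIMSEQ_D[of _ 0 "e/2"] half_gt_zero[OF e] by blast
  show "\<exists>no. \<forall>m\<ge>no. norm ((LINT x|lborel. \<bar>indicator A (x - h m) - indicator A x\<bar> :: real) - 0) < e"
  proof (intro exI[of _ N] allI impI)
    fix m assume "m \<ge> N"
    have "(LINT x|lborel. \<bar>a (x - h m) - a x\<bar>) \<le> 
      (LINT x|lborel. \<bar>u (x - h m) - a (x - h m)\<bar> + \<bar>u x - a x\<bar> + \<bar>u (x - h m) - u x\<bar>)"
      using iu ia iut iat by (intro integral_mono) auto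
    also have "\<dots> = (LINT x|lborel. \<bar>u (x - h m) - a (x - h m)\<bar>) + (LINT x|lborel. \<bar>u x - a x\<bar>) + (LINT x|lborel. \<bar>u (x - h m) - u x\<bar>)"
      using iu ia iut iat by (simp add: Bochner_Integration.integral_add)
    also have "\<dots> < e" using uat[of "h m"] ua N[OF \<open>m \<ge> N\<close>] by simp
    finally show "norm ((LINT x|lborel. \<bar>indicator A (x - h m) - indicator A x\<bar> :: real) - 0) < e"
      by (simp add: a_def)
  qed
qed

text \<open>Induction over integrable functions: multiples of indicators are the preceding case,
  sums follow from the triangle inequality, and for limits the approximation error is the same for a
  function and for its translate.\<close>

lemma L1_translation_continuous:
  fixes f :: "'a::euclidean_space \<Rightarrow> real" and h :: "nat \<Rightarrow> 'a"
  assumes f: "integrable lborel f" and h: "h \<longlonglongrightarrow> 0"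
  shows "(\<lambda>m. LINT x|lborel. \<bar>f (x - h m) - f x\<bar>) \<longlonglongrightarrow> 0"
  using f
proof induction
  case (base A c)
  have "(\<lambda>m. \<bar>c\<bar> * (LINT x|lborel. \<bar>indicator A (x - h m) - indicator A x\<bar> :: real)) \<longlonglongrightarrow> \<bar>c\<bar> * 0"
    using base by (intro tendsto_mult L1_translation_indicator h) auto
  moreover have "\<bar>c\<bar> * (LINT x|lborel. \<bar>indicator A (x - h m) - indicator A x\<bar> :: real) = 
     (LINT x|lborel. \<bar>indicator A (x - h m) *\<^sub>R c - indicator A x *\<^sub>R c\<bar>)" for m
    by (subst integral_mult_right_zero[symmetric]) (simp add: abs_mult[symmetric] algebra_simps)
  ultimately show ?case by simp
next
  case (add f g)
  have [measurable]: "f \<in> borel_measurable borel" "g \<in> borel_measurable borel"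
    using add borel_measurable_integrable by force+
  have i: "integrable lborel (\<lambda>x. f (x - k))" "integrable lborel (\<lambda>x. g (x - k))" for k
    using add by (simp_all add: lborel_integrable_translate)
  have "(\<lambda>m. (LINT x|lborel. \<bar>f (x - h m) - f x\<bar>) + (LINT x|lborel. \<bar>g (x - h m) - g x\<bar>)) \<longlonglongrightarrow> 0"
    using tendsto_add[OF add.IH] by simp
  then show ?case
  proof (rule tendsto_0_le[where K=1], intro always_eventually allI)
    fix m
    have "(LINT x|lborel. \<bar>f (x - h m) + g (x - h m) - (f x + g x)\<bar>) \<le> 
       (LINT x|lborel. \<bar>f (x - h m) - f x\<bar> + \<bar>g (x - h m) - g x\<bar>)"
      using i add by (intro integral_mono) auto
    also have "\<dots> = (LINT x|lborel. \<bar>f (x - h m) - f x\<bar>) + (LINT x|lborel. \<bar>g (x - h m) - g x\<bar>)"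
      using i add by (simp add: Bochner_Integration.integral_add)
    finally show "norm (LINT x|lborel. \<bar>f (x - h m) + g (x - h m) - (f x + g x)\<bar>)
         \<le> norm ((LINT x|lborel. \<bar>f (x - h m) - f x\<bar>) + (LINT x|lborel. \<bar>g (x - h m) - g x\<bar>)) * 1"
      by (simp add: abs_of_nonneg)
  qed
next
  case (lim f s)
  have [measurable]: "f \<in> borel_measurable borel" "\<And>i. s i \<in> borel_measurable borel"
    using lim borel_measurable_integrable by force+
  have i: "integrable lborel (\<lambda>x. f (x - k))" "integrable lborel (\<lambda>x. s i (x - k))" for k i
    using lim by (simp_all add: lborel_integrable_translate)
  have D: "(\<lambda>i. LINT x|lborel. \<bar>s i x - f x\<bar>) \<longlonglongrightarrow> (LINT x::'a|lborel. 0)"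
  \<comment> \<open>The induction provides approximations bounded by twice the modulus of
    \<open>f\<close>, so their distance to \<open>f\<close> is at most three times it.\<close>
  proof (rule integral_dominated_convergence[where w="\<lambda>x. 3 * \<bar>f x\<bar>"])
    show "AE x in lborel. (\<lambda>i. \<bar>s i x - f x\<bar>) \<longlonglongrightarrow> 0"
      using lim.hyps(2) by (auto intro!: AE_I2 tendsto_rabs_zero simp: LIM_zero_iff)
    show "AE x in lborel. norm \<bar>s i x - f x\<bar> \<le> 3 * \<bar>f x\<bar>" for i
      using lim.hyps(3)[of _ i] by (intro AE_I2) (smt (verit) real_norm_def space_lborel UNIV_I)
  qed (use lim in auto)
  show ?case
  proof (rule LIMSEQ_I)
    fix e :: real assume e: "e > 0"
    obtain i0 where i0: "(LINT x|lborel. \<bar>s i0 x - f x\<bar>) < e/4"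
      using LIMSEQ_D[OF D, of "e/4"] e by (fastforce simp: abs_of_nonneg)
    obtain N where N: "\<And>m. m \<ge> N \<Longrightarrow> (LINT x|lborel. \<bar>s i0 (x - h m) - s i0 x\<bar>) < e/2"
      using LIMSEQ_D[OF lim.IH[of i0], of "e/2"] e by (fastforce simp: abs_of_nonneg)
    show "\<exists>no. \<forall>m\<ge>no. norm ((LINT x|lborel. \<bar>f (x - h m) - f x\<bar>) - 0) < e"
    proof (intro exI[of _ N] allI impI)
      fix m assume "m \<ge> N"
      have "(LINT x|lborel. \<bar>f (x - h m) - f x\<bar>) \<le> 
        (LINT x|lborel. \<bar>s i0 (x - h m) - f (x - h m)\<bar> + \<bar>s i0 x - f x\<bar> + \<bar>s i0 (x - h m) - s i0 x\<bar>)"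
        using lim i by (intro integral_mono) auto
      also have "\<dots> = (LINT x|lborel. \<bar>s i0 (x - h m) - f (x - h m)\<bar>) + (LINT x|lborel. \<bar>s i0 x - f x\<bar>) + (LINT x|lborel. \<bar>s i0 (x - h m) - s i0 x\<bar>)"
        using lim i by (simp add: Bochner_Integration.integral_add)
      also have "(LINT x|lborel. \<bar>s i0 (x - h m) - f (x - h m)\<bar>) = (LINT x|lborel. \<bar>s i0 x - f x\<bar>)"
        by (subst lborel_integral_translate[where f="\<lambda>x. \<bar>s i0 x - f x\<bar>"]) simp_all
      finally show "norm ((LINT x|lborel. \<bar>f (x - h m) - f x\<bar>) - 0) < e"
        using i0 N[OF \<open>m \<ge> N\<close>] by (simp add: abs_of_nonneg)
    qed
  qed
qed

text \<open>For nonnegative numbers \<open>(a - b)\<^sup>2 \<le> \<bar>a\<^sup>2 - b\<^sup>2\<bar>\<close>, which reduces the statement to that in \<open>L\<^sup>1\<close>.\<close>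

lemma L2_translation_continuous:
  fixes f :: "'a::euclidean_space \<Rightarrow> complex" and h :: "nat \<Rightarrow> 'a"
  assumes [measurable]: "f \<in> borel_measurable borel"
    and f: "integrable lborel (\<lambda>x. (norm (f x))\<^sup>2)" and h: "h \<longlonglongrightarrow> 0"
  shows "(\<lambda>m. LINT x|lborel. (norm (f (x - h m) - f x))\<^sup>2) \<longlonglongrightarrow> 0"
proof -
  \<comment> \<open>The positive and negative parts of the real and imaginary parts of
    \<open>f\<close>: the comparison of squares is valid for nonnegative numbers.\<close>
  define p where "p k x = (if k = (0::nat) then max 0 (Re (f x)) else if k = 1 then max 0 (- Re (f x))
     else if k = 2 then max 0 (Im (f x)) else max 0 (- Im (f x)))" for k x
  have [measurable]: "p k \<in> borel_measurable borel" for k unfolding p_def by measurable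
  have p0: "p k x \<ge> 0" for k x by (simp add: p_def)
  have "\<bar>p k x\<bar> \<le> norm (f x)" for k x
    using abs_Re_le_cmod[of "f x"] abs_Im_le_cmod[of "f x"] by (auto simp: p_def)
  then have pf: "(p k x)\<^sup>2 \<le> (norm (f x))\<^sup>2" for k x
    by (metis abs_le_square_iff abs_norm_cancel)
  have ip: "integrable lborel (\<lambda>x. (p k x)\<^sup>2)" for k
    using f by (rule Bochner_Integration.integrable_bound) (auto intro!: AE_I2 pf)
  have ipt: "integrable lborel (\<lambda>x. (p k (x - y))\<^sup>2)" for k y
    using ip[of k] by (subst lborel_integrable_translate) auto
  have sq: "(a - b)\<^sup>2 \<le> \<bar>a\<^sup>2 - b\<^sup>2\<bar>" if "a \<ge> 0" "b \<ge> 0" for a b :: real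
  proof -
    have "(a - b)\<^sup>2 = \<bar>a - b\<bar> * \<bar>a - b\<bar>" by (simp add: power2_eq_square)
    also have "\<dots> \<le> \<bar>a - b\<bar> * \<bar>a + b\<bar>" using that by (intro mult_left_mono) auto
    also have "\<dots> = \<bar>a\<^sup>2 - b\<^sup>2\<bar>" by (simp add: abs_mult[symmetric] power2_eq_square algebra_simps)
    finally show ?thesis .
  qed
  have sq2: "(a - b)\<^sup>2 \<le> 2 * a\<^sup>2 + 2 * b\<^sup>2" for a b :: real
    using zero_le_power2[of "a + b"] by (simp add: power2_sum power2_diff)
  have bd: "(norm (f y - f x))\<^sup>2 \<le> (\<Sum>k<4. 2 * \<bar>(p k y)\<^sup>2 - (p k x)\<^sup>2\<bar>)" for x y
  proof -
    have "(norm (f y - f x))\<^sup>2 = ((p 0 y - p 0 x) - (p 1 y - p 1 x))\<^sup>2 + ((p 2 y - p 2 x) - (p 3 y - p 3 x))\<^sup>2"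
      unfolding cmod_power2 by (intro arg_cong2[where f="(+)"] arg_cong[where f="\<lambda>x. x^2"]) (auto simp: p_def max_def)
    also have "\<dots> \<le> (2 * (p 0 y - p 0 x)\<^sup>2 + 2 * (p 1 y - p 1 x)\<^sup>2) + (2 * (p 2 y - p 2 x)\<^sup>2 + 2 * (p 3 y - p 3 x)\<^sup>2)"
      by (intro add_mono sq2)
    also have "\<dots> \<le> (2 * \<bar>(p 0 y)\<^sup>2 - (p 0 x)\<^sup>2\<bar> + 2 * \<bar>(p 1 y)\<^sup>2 - (p 1 x)\<^sup>2\<bar>) + 
       (2 * \<bar>(p 2 y)\<^sup>2 - (p 2 x)\<^sup>2\<bar> + 2 * \<bar>(p 3 y)\<^sup>2 - (p 3 x)\<^sup>2\<bar>)"
      by (intro add_mono mult_left_mono sq p0) auto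
    also have "\<dots> = (\<Sum>k<4. 2 * \<bar>(p k y)\<^sup>2 - (p k x)\<^sup>2\<bar>)"
      by (simp add: numeral_eq_Suc)
    finally show ?thesis .
  qed
  have "(\<lambda>m. \<Sum>k<4. 2 * (LINT x|lborel. \<bar>(p k (x - h m))\<^sup>2 - (p k x)\<^sup>2\<bar>)) \<longlonglongrightarrow> (\<Sum>k<(4::nat). 2 * 0)"
    by (intro tendsto_intros L1_translation_continuous[where f="\<lambda>x. (p _ x)\<^sup>2"] ip h)
  then have "(\<lambda>m. \<Sum>k<4. 2 * (LINT x|lborel. \<bar>(p k (x - h m))\<^sup>2 - (p k x)\<^sup>2\<bar>)) \<longlonglongrightarrow> 0" by simp
  then show ?thesis
  proof (rule tendsto_0_le[where K=1], intro always_eventually allI)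
    fix m
    have ii: "integrable lborel (\<lambda>x. 2 * \<bar>(p k (x - h m))\<^sup>2 - (p k x)\<^sup>2\<bar>)" for k
      using ip ipt by simp
    have "(LINT x|lborel. (norm (f (x - h m) - f x))\<^sup>2) \<le> (LINT x|lborel. (\<Sum>k<4. 2 * \<bar>(p k (x - h m))\<^sup>2 - (p k x)\<^sup>2\<bar>))"
    proof (rule integral_mono)
      show i: "integrable lborel (\<lambda>x. \<Sum>k<4. 2 * \<bar>(p k (x - h m))\<^sup>2 - (p k x)\<^sup>2\<bar>)"
        by (intro Bochner_Integration.integrable_sum ii)
      show "integrable lborel (\<lambda>x. (norm (f (x - h m) - f x))\<^sup>2)"
        using i by (rule Bochner_Integration.integrable_bound) (auto intro!: AE_I2 order_trans[OF bd] simp: sum_nonneg)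
    qed (rule bd)
    also have "\<dots> = (\<Sum>k<4. 2 * (LINT x|lborel. \<bar>(p k (x - h m))\<^sup>2 - (p k x)\<^sup>2\<bar>))"
      using ii by (subst Bochner_Integration.integral_sum) auto
    finally show "norm (LINT x|lborel. (norm (f (x - h m) - f x))\<^sup>2) \<le> 
       norm (\<Sum>k<4. 2 * (LINT x|lborel. \<bar>(p k (x - h m))\<^sup>2 - (p k x)\<^sup>2\<bar>)) * 1"
      by (simp add: abs_of_nonneg sum_nonneg)
  qed
qed

section \<open>The Fourier transform of integrable functions\<close>

lemma lborel_integrable_affine:
  fixes f :: "'a::euclidean_space \<Rightarrow> 'b::{banach,second_countable_topology}"
  assumes f: "integrable lborel f" and c: "c > 0"
  shows "integrable lborel (\<lambda>x. f (t + c *\<^sub>R x))"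
proof -
  have [measurable]: "f \<in> borel_measurable borel"
    using f borel_measurable_integrable by force
  have "(\<integral>\<^sup>+x. ennreal (norm (f x)) \<partial>lborel) = 
      (\<integral>\<^sup>+x. ennreal (norm (f x)) \<partial>density (distr lborel borel (\<lambda>x. t + c *\<^sub>R x)) (\<lambda>_. ennreal (\<bar>c\<bar> ^ DIM('a))))"
    using c by (subst lborel_affine[of c t]) auto
  also have "\<dots> = ennreal (c ^ DIM('a)) * (\<integral>\<^sup>+x. ennreal (norm (f (t + c *\<^sub>R x))) \<partial>lborel)"
    using c by (subst nn_integral_density) (simp_all add: nn_integral_distr nn_integral_cmult)
  finally show ?thesis
    using f c unfolding integrable_iff_bounded by (auto simp: ennreal_mult_less_top)
qed

section \<open>Fourier integrals and the multiplication formula\<close>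

text \<open>The parameter is the reciprocal of the width: a small \<open>s\<close> leaves large
  regions almost undamped.\<close>

abbreviation gauss :: "real \<Rightarrow> 'a::euclidean_space \<Rightarrow> complex" where
  "gauss s x \<equiv> complex_of_real (exp (- (s * norm x)\<^sup>2 / 2))"

abbreviation fourier_const :: "'n::finite itself \<Rightarrow> real" where
  "fourier_const _ \<equiv> (2 * pi) powr (- real CARD('n) / 2)"

text \<open>The normalising factor cancels the total mass of the standard Gaussian, which is why no
  constant survives in Plancherel's identity.\<close>

lemma fourier_const_sqrt: "fourier_const TYPE('n::finite) * sqrt (2 * pi) ^ CARD('n) = 1"
proof -
  have "sqrt (2 * pi) ^ CARD('n) = ((2 * pi) powr (1 / 2)) ^ CARD('n)"
    by (simp add: powr_half_sqrt)
  also have "\<dots> = (2 * pi) powr (real CARD('n) / 2)"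
    by (subst powr_power) simp_all
  finally show ?thesis by (simp add: powr_minus)
qed

lemma borel_measurable_cnj [measurable (raw)]:
  "f \<in> borel_measurable M \<Longrightarrow> (\<lambda>x. cnj (f x)) \<in> borel_measurable M"
  by (rule borel_measurable_continuous_on[OF continuous_on_cnj[OF continuous_on_id]])

lemma fourier_L1_borel:
  fixes f :: "real^'n \<Rightarrow> complex"
  assumes [measurable]: "f \<in> borel_measurable borel"
  shows "fourier_L1 f \<xi> = of_real (fourier_const TYPE('n)) * (LINT x|lborel. f x * exp (- \<i> * of_real (x \<bullet> \<xi>)))"
  unfolding fourier_L1_def by (subst integral_completion) simp_all

lemma fourier_L1_measurable:
  fixes f :: "real^'n \<Rightarrow> complex"
  assumes [measurable]: "f \<in> borel_measurable borel"
  shows "fourier_L1 f \<in> borel_measurable borel"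
  unfolding fourier_L1_borel[OF assms, abs_def] by measurable

lemma norm_fourier_L1_le:
  fixes f :: "real^'n \<Rightarrow> complex"
  shows "norm (fourier_L1 f \<xi>) \<le> fourier_const TYPE('n) * (LINT x|lebesgue. norm (f x))"
proof -
  have "norm (LINT x|lebesgue. f x * exp (- \<i> * of_real (x \<bullet> \<xi>))) \<le> (LINT x|lebesgue. norm (f x * exp (- \<i> * of_real (x \<bullet> \<xi>))))"
    by (rule integral_norm_bound)
  also have "\<dots> = (LINT x|lebesgue. norm (f x))"
    by (simp add: norm_mult norm_exp_eq_Re)
  finally show ?thesis
    unfolding fourier_L1_def norm_mult by (simp add: mult_left_mono)
qed

lemma integrable_fourier_kernel:
  fixes f :: "'a::euclidean_space \<Rightarrow> complex"
  assumes "integrable M f" and [measurable]: "M \<in> {lborel, lebesgue}"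
  shows "integrable M (\<lambda>x. f x * exp (- \<i> * of_real (x \<bullet> \<xi>)))"
proof -
  have [measurable]: "f \<in> borel_measurable M" using assms by auto
  have "(\<lambda>x. exp (- \<i> * of_real (x \<bullet> \<xi>))) \<in> borel_measurable M"
    using assms(2) by (auto intro: measurable_completion)
  then show ?thesis
    by (intro Bochner_Integration.integrable_bound[OF assms(1)] borel_measurable_times) 
      (auto simp: norm_mult norm_exp_eq_Re)
qed

text \<open>The kernel is symmetric in \<open>x\<close> and \<open>\<xi>\<close>, so Fubini's
  theorem moves the transform from one factor to the other.\<close>

lemma fourier_L1_mult_borel:
  fixes f g :: "real^'n \<Rightarrow> complex"
  assumes f: "integrable lborel f" and g: "integrable lborel g"
  shows "(LINT \<xi>|lborel. fourier_L1 f \<xi> * g \<xi>) = (LINT x|lborel. f x * fourier_L1 g x)"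
proof -
  have [measurable]: "f \<in> borel_measurable borel" "g \<in> borel_measurable borel"
    using f g borel_measurable_integrable by force+
  let ?c = "complex_of_real (fourier_const TYPE('n))"
  let ?e = "\<lambda>x \<xi> :: real^'n. exp (- \<i> * complex_of_real (x \<bullet> \<xi>))"
  have ne: "norm (?e x \<xi>) = 1" for x \<xi> by (simp add: norm_exp_eq_Re)
  have int: "integrable (lborel \<Otimes>\<^sub>M lborel) (\<lambda>(x, \<xi>). f x * g \<xi> * ?e x \<xi>)"
  proof (rule lborel_pair.Fubini_integrable)
    show "(\<lambda>(x, \<xi>). f x * g \<xi> * ?e x \<xi>) \<in> borel_measurable (lborel \<Otimes>\<^sub>M lborel)"
      by measurable
    show "integrable lborel (\<lambda>x. LINT y|lborel. norm (case (x, y) of (x, \<xi>) \<Rightarrow> f x * g \<xi> * ?e x \<xi>))"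
      using f by (simp add: norm_mult ne)
    show "AE x in lborel. integrable lborel (\<lambda>y. case (x, y) of (x, \<xi>) \<Rightarrow> f x * g \<xi> * ?e x \<xi>)"
      using integrable_fourier_kernel[OF g] by (simp add: inner_commute mult.assoc)
  qed
  have "(LINT \<xi>|lborel. fourier_L1 f \<xi> * g \<xi>) = (LINT \<xi>|lborel. ?c * (LINT x|lborel. f x * g \<xi> * ?e x \<xi>))"
  proof (rule Bochner_Integration.integral_cong)
    fix \<xi>
    have "(LINT x|lborel. f x * g \<xi> * ?e x \<xi>) = g \<xi> * (LINT x|lborel. f x * ?e x \<xi>)"
      by (subst integral_mult_right_zero[symmetric]) (simp add: mult_ac)
    then show "fourier_L1 f \<xi> * g \<xi> = ?c * (LINT x|lborel. f x * g \<xi> * ?e x \<xi>)"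
      by (simp add: fourier_L1_borel)
  qed simp
  also have "\<dots> = ?c * (LINT x|lborel. LINT \<xi>|lborel. f x * g \<xi> * ?e x \<xi>)"
    using lborel_pair.Fubini_integral[OF int] by simp
  also have "\<dots> = (LINT x|lborel. f x * fourier_L1 g x)"
  proof (subst integral_mult_right_zero[symmetric], rule Bochner_Integration.integral_cong)
    fix x
    have "(LINT \<xi>|lborel. f x * g \<xi> * ?e x \<xi>) = f x * (LINT \<xi>|lborel. g \<xi> * ?e \<xi> x)"
      by (subst integral_mult_right_zero[symmetric]) (simp add: mult_ac inner_commute)
    then show "?c * (LINT \<xi>|lborel. f x * g \<xi> * ?e x \<xi>) = f x * fourier_L1 g x"
      by (simp add: fourier_L1_borel)
  qed simp
  finally show ?thesis .
qed

text \<open>Rescaling reduces the claim to width 1, where the Gaussian is its own transform.\<close>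

lemma
  fixes y :: "real^'n"
  assumes s: "s > 0"
  shows integrable_gauss: "integrable lborel (gauss s :: real^'n \<Rightarrow> complex)" (is ?int)
    and fourier_L1_gauss: "fourier_L1 (gauss s) y = gauss (1 / s) y / of_real (s ^ CARD('n))" (is ?eq)
proof -
  have g1: "integrable lborel (\<lambda>x::real^'n. gauss 1 x)"
    using integrable_gaussian_iexp[of 0] by simp
  show ?int
  proof -
    have "integrable lborel (\<lambda>x::real^'n. gauss 1 (0 + s *\<^sub>R x))"
      by (rule lborel_integrable_affine[OF g1 s])
    then show ?thesis using s by simp
  qed
  have "complex_of_real (sqrt (2 * pi) ^ CARD('n)) * gauss (1 / s) y = 
    (LINT x|lborel. gauss 1 x * exp (- \<i> * of_real (x \<bullet> (y /\<^sub>R s))))"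
  proof -
    have "norm (y /\<^sub>R s) = 1 / s * norm y" using s by (simp add: field_simps)
    then show ?thesis using integral_gaussian_iexp[of "y /\<^sub>R s"] by simp
  qed
  also have "\<dots> = s ^ CARD('n) *\<^sub>R (LINT x|lborel. gauss s x * exp (- \<i> * of_real (x \<bullet> y)))"
  proof -
    have e: "inverse (complex_of_real s) * (complex_of_real s * z) = z" for z using s by simp
    show ?thesis using s by (subst lborel_integral_affine[where c=s and t=0]) (simp_all add: e)
  qed
  finally have "(LINT x|lborel. gauss s x * exp (- \<i> * of_real (x \<bullet> y))) = 
     complex_of_real (sqrt (2 * pi) ^ CARD('n)) * gauss (1 / s) y / of_real (s ^ CARD('n))"
    using s by (simp add: scaleR_conv_of_real field_simps)
  then have "fourier_L1 (gauss s) y = complex_of_real (fourier_const TYPE('n) * sqrt (2 * pi) ^ CARD('n)) * 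
      gauss (1 / s) y / of_real (s ^ CARD('n))"
    by (subst fourier_L1_borel) simp_all
  then show ?eq unfolding fourier_const_sqrt by simp
qed

lemma lborel_distr_uminus_euclidean: "distr lborel borel uminus = (lborel :: 'a::euclidean_space measure)"
  by (subst lborel_affine[of "-1" 0]) (simp_all add: density_1 cong: distr_cong)

section \<open>Plancherel's identity for integrable square integrable functions\<close>

text \<open>The Gaussian makes the conjugate transform integrable, so the multiplication formula can
  shift the outer transform from \<open>f\<close> to the damped factor \<open>w\<close>. The
  transform of \<open>w\<close> is a Gaussian average of translates of \<open>cnj f\<close>, and
  Fubini's theorem exchanges that average with the integral over \<open>x\<close>.\<close>

lemma plancherel_damped:
  fixes f :: "real^'n \<Rightarrow> complex"
  assumes f: "integrable lborel f" and f2: "integrable lborel (\<lambda>x. (norm (f x))\<^sup>2)" and s: "s > 0"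
  shows "(LINT \<xi>|lborel. fourier_L1 f \<xi> * (cnj (fourier_L1 f \<xi>) * gauss s \<xi>)) =
    of_real (fourier_const TYPE('n)) * (LINT u|lborel. gauss 1 u * (LINT x|lborel. f x * cnj (f (x - s *\<^sub>R u))))"
proof -
  have [measurable]: "f \<in> borel_measurable borel"
    using f borel_measurable_integrable by force
  note [measurable] = fourier_L1_measurable
  let ?c = "complex_of_real (fourier_const TYPE('n))"
  let ?n = "CARD('n)"
  have [measurable]: "(\<lambda>x. cnj (f (- x))) \<in> borel_measurable borel"
    by (intro borel_measurable_cnj) measurable
  define w where "w \<xi> = cnj (fourier_L1 f \<xi>) * gauss s \<xi>" for \<xi>
  have [measurable]: "w \<in> borel_measurable borel"
    unfolding w_def by (intro borel_measurable_times borel_measurable_cnj) measurable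
  have w: "integrable lborel w"
  proof (rule Bochner_Integration.integrable_bound)
    show "integrable lborel (\<lambda>\<xi>::real^'n. (fourier_const TYPE('n) * (LINT x|lebesgue. norm (f x))) *\<^sub>R gauss s \<xi>)"
      using integrable_gauss[OF s] by (intro integrable_scaleR_right) simp
    show "AE \<xi> in lborel. norm (w \<xi>) \<le> norm ((fourier_const TYPE('n) * (LINT x|lebesgue. norm (f x))) *\<^sub>R gauss s \<xi>)"
      using norm_fourier_L1_le[of f] by (auto simp: w_def norm_mult mult_right_mono)
  qed simp
  \<comment> \<open>Writing the conjugate transform as a transform, namely of the reflected
    conjugate, allows a second use of the multiplication formula.\<close>
  have cnjF: "cnj (fourier_L1 f \<xi>) = fourier_L1 (\<lambda>x. cnj (f (- x))) \<xi>" for \<xi>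
  proof -
    have "(LINT x|lborel. cnj (f (- x)) * exp (- \<i> * of_real (x \<bullet> \<xi>))) = 
      (LINT x|distr lborel borel uminus. cnj (f (- x)) * exp (- \<i> * of_real (x \<bullet> \<xi>)))"
      by (simp add: lborel_distr_uminus_euclidean)
    also have "\<dots> = (LINT x|lborel. cnj (f x) * exp (\<i> * of_real (x \<bullet> \<xi>)))"
      by (subst integral_distr) auto
    also have "\<dots> = cnj (LINT x|lborel. f x * exp (- \<i> * of_real (x \<bullet> \<xi>)))"
    proof -
      have "integrable lborel (\<lambda>x. f x * exp (- \<i> * of_real (x \<bullet> \<xi>)))"
        by (intro integrable_fourier_kernel f) simp
      from integral_bounded_linear[OF bounded_linear_cnj this] show ?thesis
        by (simp add: exp_cnj)
    qed
    finally show ?thesis by (simp add: fourier_L1_borel)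
  qed
  have fm: "integrable lborel (\<lambda>x. cnj (f (- x)))"
  proof -
    have "integrable (distr lborel borel uminus) f" using f by (simp add: lborel_distr_uminus_euclidean)
    then have "integrable lborel (\<lambda>x. f (- x))" by (subst (asm) integrable_distr_eq) auto
    then show ?thesis by simp
  qed
  \<comment> \<open>The character is absorbed into the Gaussian, whose transform becomes a
    translated Gaussian centred at \<open>-x\<close>; the substitution \<open>y = - x + s u\<close>
    then gives it width 1.\<close>
  have Fw: "fourier_L1 w x = ?c * (LINT u|lborel. gauss 1 u * cnj (f (x - s *\<^sub>R u)))" for x
  proof -
    let ?g = "\<lambda>\<xi>. gauss s \<xi> * exp (- \<i> * of_real (\<xi> \<bullet> x))"
    have g: "integrable lborel ?g"
      by (intro integrable_fourier_kernel integrable_gauss s) auto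
    have Fg: "fourier_L1 ?g y = gauss (1 / s) (x + y) / of_real (s ^ ?n)" for y
    proof -
      have "fourier_L1 ?g y = fourier_L1 (gauss s) (x + y)"
        by (simp add: fourier_L1_def inner_add_right mult.assoc flip: exp_add) (simp add: algebra_simps)
      then show ?thesis by (simp only: fourier_L1_gauss[OF s])
    qed
    have "fourier_L1 w x = ?c * (LINT \<xi>|lborel. fourier_L1 (\<lambda>x. cnj (f (- x))) \<xi> * ?g \<xi>)"
      by (subst fourier_L1_borel) (simp_all add: w_def cnjF mult.assoc)
    also have "\<dots> = ?c * (LINT y|lborel. cnj (f (- y)) * (gauss (1 / s) (x + y) / of_real (s ^ ?n)))"
      by (simp only: fourier_L1_mult_borel[OF fm g] Fg)
    also have "(LINT y|lborel. cnj (f (- y)) * (gauss (1 / s) (x + y) / of_real (s ^ ?n))) = 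
       s ^ DIM(real^'n) *\<^sub>R (LINT u|lborel. cnj (f (- (- x + s *\<^sub>R u))) * (gauss (1 / s) (x + (- x + s *\<^sub>R u)) / of_real (s ^ ?n)))"
      by (rule lborel_integral_affine) (use s in measurable)
    also have "\<dots> = (LINT u|lborel. gauss 1 u * cnj (f (x - s *\<^sub>R u)))"
    proof (subst integral_scaleR_right[symmetric], rule Bochner_Integration.integral_cong)
      fix u :: "real^'n"
      have "1 / s * norm (x + (- x + s *\<^sub>R u)) = 1 * norm u" using s by simp
      moreover have "- (- x + s *\<^sub>R u) = x - s *\<^sub>R u" by simp
      ultimately show "s ^ DIM(real^'n) *\<^sub>R (cnj (f (- (- x + s *\<^sub>R u))) * (gauss (1 / s) (x + (- x + s *\<^sub>R u)) / of_real (s ^ ?n)))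
          = gauss 1 u * cnj (f (x - s *\<^sub>R u))"
        using s by (simp only:) (simp add: scaleR_conv_of_real[where 'a=complex])
    qed simp
    finally show ?thesis .
  qed
  \<comment> \<open>The modulus of a product is at most the sum of the squared moduli, so the inner
    integral is bounded independently of \<open>u\<close> and the Gaussian dominates.\<close>
  have int: "integrable (lborel \<Otimes>\<^sub>M lborel) (\<lambda>(u, x). gauss 1 u * (f x * cnj (f (x - s *\<^sub>R u))))"
  proof (rule lborel_pair.Fubini_integrable)
    have b: "norm (a * cnj b) \<le> (norm a)\<^sup>2 + (norm b)\<^sup>2" for a b :: complex
      using sum_squares_bound[of "norm a" "norm b"] mult_nonneg_nonneg[OF norm_ge_zero[of a] norm_ge_zero[of b]]
      unfolding norm_mult complex_mod_cnj by linarith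
    have tr: "integrable lborel (\<lambda>x. (norm (f (x - k)))\<^sup>2)" for k
      using f2 by (subst lborel_integrable_translate[where f="\<lambda>x. (norm (f x))\<^sup>2"]) auto
    have i: "integrable lborel (\<lambda>x. f x * cnj (f (x - k)))" for k
      using Bochner_Integration.integrable_add[OF f2 tr[of k]]
      by (rule Bochner_Integration.integrable_bound) (auto intro!: AE_I2 order_trans[OF b])
    show "(\<lambda>(u, x). gauss 1 u * (f x * cnj (f (x - s *\<^sub>R u)))) \<in> borel_measurable (lborel \<Otimes>\<^sub>M lborel)"
      by measurable
    show "AE u in lborel. integrable lborel (\<lambda>x. case (u, x) of (u, x) \<Rightarrow> gauss 1 u * (f x * cnj (f (x - s *\<^sub>R u))))"
      using i by simp
    show "integrable lborel (\<lambda>u. LINT x|lborel. norm (case (u, x) of (u, x) \<Rightarrow> gauss 1 u * (f x * cnj (f (x - s *\<^sub>R u)))))"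
    proof (rule Bochner_Integration.integrable_bound)
      show "integrable lborel (\<lambda>u::real^'n. (2 * (LINT x|lborel. (norm (f x))\<^sup>2)) *\<^sub>R gauss 1 u)"
        using integrable_gauss[of 1] by (intro integrable_scaleR_right) simp
      show "(\<lambda>u. LINT x|lborel. norm (case (u, x) of (u, x) \<Rightarrow> gauss 1 u * (f x * cnj (f (x - s *\<^sub>R u))))) \<in> borel_measurable lborel"
        by measurable
      show "AE u in lborel. norm (LINT x|lborel. norm (case (u, x) of (u, x) \<Rightarrow> gauss 1 u * (f x * cnj (f (x - s *\<^sub>R u)))))
          \<le> norm ((2 * (LINT x|lborel. (norm (f x))\<^sup>2)) *\<^sub>R gauss 1 u)"
      proof (rule AE_I2)
        fix u :: "real^'n"
        have "(LINT x|lborel. norm (f x * cnj (f (x - s *\<^sub>R u)))) \<le> (LINT x|lborel. (norm (f x))\<^sup>2 + (norm (f (x - s *\<^sub>R u)))\<^sup>2)"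
          using i f2 tr b by (intro integral_mono) auto
        also have "\<dots> = 2 * (LINT x|lborel. (norm (f x))\<^sup>2)"
          using f2 tr by (simp add: Bochner_Integration.integral_add lborel_integral_translate[where f="\<lambda>x. (norm (f x))\<^sup>2"])
        finally have "norm (gauss 1 u) * (LINT x|lborel. norm (f x * cnj (f (x - s *\<^sub>R u)))) \<le> norm (gauss 1 u) * (2 * (LINT x|lborel. (norm (f x))\<^sup>2))"
          by (intro mult_left_mono) auto
        moreover have "(LINT x|lborel. norm (case (u, x) of (u, x) \<Rightarrow> gauss 1 u * (f x * cnj (f (x - s *\<^sub>R u))))) =
            norm (gauss 1 u) * (LINT x|lborel. norm (f x * cnj (f (x - s *\<^sub>R u))))"
          by (simp only: split_conv norm_mult[of "gauss 1 u"] integral_mult_right_zero)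
        ultimately show "norm (LINT x|lborel. norm (case (u, x) of (u, x) \<Rightarrow> gauss 1 u * (f x * cnj (f (x - s *\<^sub>R u)))))
          \<le> norm ((2 * (LINT x|lborel. (norm (f x))\<^sup>2)) *\<^sub>R gauss 1 u)"
          by (simp add: abs_mult mult_ac)
      qed
    qed
  qed
  have "(LINT \<xi>|lborel. fourier_L1 f \<xi> * w \<xi>) = (LINT x|lborel. f x * fourier_L1 w x)"
    by (rule fourier_L1_mult_borel[OF f w])
  also have "\<dots> = (LINT x|lborel. ?c * (LINT u|lborel. gauss 1 u * (f x * cnj (f (x - s *\<^sub>R u)))))"
  proof (rule Bochner_Integration.integral_cong)
    fix x
    have "(LINT u|lborel. gauss 1 u * (f x * cnj (f (x - s *\<^sub>R u)))) = f x * (LINT u|lborel. gauss 1 u * cnj (f (x - s *\<^sub>R u)))"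
      by (subst integral_mult_right_zero[symmetric]) (simp add: mult_ac)
    then show "f x * fourier_L1 w x = ?c * (LINT u|lborel. gauss 1 u * (f x * cnj (f (x - s *\<^sub>R u))))"
      by (simp add: Fw)
  qed simp
  also have "\<dots> = ?c * (LINT u|lborel. LINT x|lborel. gauss 1 u * (f x * cnj (f (x - s *\<^sub>R u))))"
    using lborel_pair.Fubini_integral[OF int] by simp
  finally show ?thesis unfolding w_def by simp
qed

text \<open>The inequality for extended nonnegative integrals of the moduli yields integrability and
  the bound together. The pairing is bilinear; conjugates are put in where an inner product is
  wanted.\<close>

lemma
  fixes f g :: "'a \<Rightarrow> complex"
  assumes [measurable]: "f \<in> borel_measurable M" "g \<in> borel_measurable M"
    and f: "integrable M (\<lambda>x. (norm (f x))\<^sup>2)" and g: "integrable M (\<lambda>x. (norm (g x))\<^sup>2)"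
  shows square_integrable_mult: "integrable M (\<lambda>x. f x * g x)" (is ?int)
    and square_integrable_Cauchy_Schwarz:
      "norm (LINT x|M. f x * g x) \<le> sqrt (LINT x|M. (norm (f x))\<^sup>2) * sqrt (LINT x|M. (norm (g x))\<^sup>2)" (is ?le)
proof -
  have f': "(\<integral>\<^sup>+x. (ennreal (norm (f x)))\<^sup>2 \<partial>M) = ennreal (LINT x|M. (norm (f x))\<^sup>2)"
    using f by (simp add: ennreal_power nn_integral_eq_integral)
  have g': "(\<integral>\<^sup>+x. (ennreal (norm (g x)))\<^sup>2 \<partial>M) = ennreal (LINT x|M. (norm (g x))\<^sup>2)"
    using g by (simp add: ennreal_power nn_integral_eq_integral)
  have "(\<integral>\<^sup>+x. ennreal (norm (f x)) * ennreal (norm (g x)) \<partial>M)\<^sup>2 \<le> 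
     ennreal (LINT x|M. (norm (f x))\<^sup>2) * ennreal (LINT x|M. (norm (g x))\<^sup>2)"
    unfolding f'[symmetric] g'[symmetric] by (rule Cauchy_Schwarz_nn_integral) auto
  also have "\<dots> = (ennreal (sqrt (LINT x|M. (norm (f x))\<^sup>2) * sqrt (LINT x|M. (norm (g x))\<^sup>2)))\<^sup>2"
    by (simp add: ennreal_power power_mult_distrib flip: ennreal_mult)
  finally have le: "(\<integral>\<^sup>+x. ennreal (norm (f x * g x)) \<partial>M) \<le> 
      ennreal (sqrt (LINT x|M. (norm (f x))\<^sup>2) * sqrt (LINT x|M. (norm (g x))\<^sup>2))"
    unfolding norm_mult ennreal_mult'[OF norm_ge_zero]
  proof -
    have sq: "A \<le> ennreal b" if "A\<^sup>2 \<le> (ennreal b)\<^sup>2" "b \<ge> 0" for A :: ennreal and b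
    proof (cases A)
      case (real r)
      then have "r\<^sup>2 \<le> b\<^sup>2" using that by (simp add: ennreal_power)
      then have "r \<le> b" using that(2) by (rule power2_le_imp_le)
      then show ?thesis using real by (simp add: ennreal_leI)
    next
      case top
      then show ?thesis using that by (simp add: ennreal_power top_unique)
    qed
    assume "(\<integral>\<^sup>+x. ennreal (norm (f x)) * ennreal (norm (g x)) \<partial>M)\<^sup>2 \<le> 
      (ennreal (sqrt (LINT x|M. (norm (f x))\<^sup>2) * sqrt (LINT x|M. (norm (g x))\<^sup>2)))\<^sup>2"
    then show "(\<integral>\<^sup>+x. ennreal (norm (f x)) * ennreal (norm (g x)) \<partial>M) \<le> 
      ennreal (sqrt (LINT x|M. (norm (f x))\<^sup>2) * sqrt (LINT x|M. (norm (g x))\<^sup>2))"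
      by (rule sq) simp
  qed
  show i: ?int
  proof (intro integrableI_bounded)
    show "(\<integral>\<^sup>+x. ennreal (norm (f x * g x)) \<partial>M) < \<infinity>"
      using le by (rule le_less_trans) simp
  qed measurable
  have "ennreal (norm (LINT x|M. f x * g x)) \<le> (\<integral>\<^sup>+x. ennreal (norm (f x * g x)) \<partial>M)"
    by (rule integral_norm_bound_ennreal[OF i])
  from order_trans[OF this le] show ?le by (subst (asm) ennreal_le_iff) simp_all
qed

text \<open>The left side is an extended integral because square integrability of the transform is
  part of the claim. The damped integrals increase to it, while their other form converges by
  continuity of the autocorrelation at 0.\<close>

lemma plancherel_borel:
  fixes f :: "real^'n \<Rightarrow> complex"
  assumes f: "integrable lborel f" and f2: "integrable lborel (\<lambda>x. (norm (f x))\<^sup>2)"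
  shows "(\<integral>\<^sup>+\<xi>. ennreal ((norm (fourier_L1 f \<xi>))\<^sup>2) \<partial>lborel) = ennreal (LINT x|lborel. (norm (f x))\<^sup>2)"
proof -
  have [measurable]: "f \<in> borel_measurable borel"
    using f borel_measurable_integrable by force
  have [measurable]: "fourier_L1 f \<in> borel_measurable borel"
    by (rule fourier_L1_measurable) simp
  define S where "S = (LINT x|lborel. (norm (f x))\<^sup>2)"
  have S0: "S \<ge> 0" unfolding S_def by simp
  define \<psi> where "\<psi> h = (LINT x|lborel. f x * cnj (f (x - h)))" for h
  have [measurable]: "\<psi> \<in> borel_measurable borel" unfolding \<psi>_def by measurable
  have tr: "integrable lborel (\<lambda>x. (norm (f (x - k)))\<^sup>2)" 
     "(LINT x|lborel. (norm (f (x - k)))\<^sup>2) = S" for k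
    using f2 lborel_integrable_translate[where f="\<lambda>x. (norm (f x))\<^sup>2"]
      lborel_integral_translate[where f="\<lambda>x. (norm (f x))\<^sup>2"] unfolding S_def by auto
  have \<psi>_le: "norm (\<psi> h) \<le> S" for h
    using square_integrable_Cauchy_Schwarz[of f lborel "\<lambda>x. cnj (f (x - h))"] f2 tr[of h] S0
    unfolding \<psi>_def S_def[symmetric] by simp
  \<comment> \<open>The difference of \<open>\<psi>\<close> at a translation and at 0 pairs
    \<open>f\<close> with the difference of its translate and itself, which is small in L2.\<close>
  have \<psi>_lim: "(\<lambda>m. \<psi> (h m)) \<longlonglongrightarrow> of_real S" if h: "h \<longlonglongrightarrow> 0" for h :: "nat \<Rightarrow> real^'n"
  proof -
    have "(\<lambda>m. sqrt S * sqrt (LINT x|lborel. (norm (f (x - h m) - f x))\<^sup>2)) \<longlonglongrightarrow> sqrt S * sqrt 0"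
      by (intro tendsto_intros L2_translation_continuous f2 h) simp
    then have "(\<lambda>m. sqrt S * sqrt (LINT x|lborel. (norm (f (x - h m) - f x))\<^sup>2)) \<longlonglongrightarrow> 0" by simp
    moreover have "norm (\<psi> (h m) - of_real S) \<le> sqrt S * sqrt (LINT x|lborel. (norm (f (x - h m) - f x))\<^sup>2)" for m
    proof -
      have bd: "(norm (a - b))\<^sup>2 \<le> 2 * (norm a)\<^sup>2 + 2 * (norm b)\<^sup>2" for a b :: complex
        using power_mono[OF norm_triangle_ineq4[of a b] norm_ge_zero, of 2] sum_squares_bound[of "norm a" "norm b"]
        by (simp add: power2_sum)
      have d: "integrable lborel (\<lambda>x. (norm (f (x - h m) - f x))\<^sup>2)"
        by (rule Bochner_Integration.integrable_bound[of _ "\<lambda>x. 2 * (norm (f (x - h m)))\<^sup>2 + 2 * (norm (f x))\<^sup>2"])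
          (use tr f2 bd in auto)
      have ff: "integrable lborel (\<lambda>x. f x * cnj (f x))" 
        by (rule square_integrable_mult) (use f2 in auto)
      have ft: "integrable lborel (\<lambda>x. f x * cnj (f (x - h m)))" 
        by (rule square_integrable_mult) (use f2 tr in auto)
      have "of_real S = (LINT x|lborel. f x * cnj (f x))"
        unfolding S_def by (simp add: complex_norm_square[symmetric] flip: of_real_power)
      then have "\<psi> (h m) - of_real S = (LINT x|lborel. f x * cnj (f (x - h m) - f x))"
        unfolding \<psi>_def using ff ft by (simp add: algebra_simps)
      then show ?thesis
        using square_integrable_Cauchy_Schwarz[of f lborel "\<lambda>x. cnj (f (x - h m) - f x)"] f2 d
        by (simp add: S_def flip: complex_cnj_diff)
    qed
    ultimately have "(\<lambda>m. \<psi> (h m) - of_real S) \<longlonglongrightarrow> 0"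
      by (rule Lim_null_comparison[OF always_eventually[OF allI], rotated])
    then show ?thesis by (simp add: LIM_zero_iff)
  qed
  \<comment> \<open>Scales decreasing to 0, so that the Gaussian factors increase to 1 and monotone
    convergence applies.\<close>
  define s where "s m = 1 / (real m + 1)" for m
  have s: "s m > 0" for m by (simp add: s_def)
  have slim: "s \<longlonglongrightarrow> 0"
    unfolding s_def using LIMSEQ_inverse_real_of_nat by (simp add: inverse_eq_divide add.commute)
  \<comment> \<open>The bound \<open>S\<close> for the autocorrelation does not depend on the
    translation, so a multiple of the Gaussian dominates all integrands.\<close>
  have lim1: "(\<lambda>m. LINT u|lborel. gauss 1 u * \<psi> (s m *\<^sub>R u)) \<longlonglongrightarrow> (LINT u::real^'n|lborel. gauss 1 u * of_real S)"
  proof (rule integral_dominated_convergence[where w="\<lambda>u. norm (gauss 1 u) * S"])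
    show "integrable lborel (\<lambda>u::real^'n. norm (gauss 1 u) * S)"
      using integrable_gauss[of 1] by (intro integrable_mult_left integrable_norm) simp
    show "AE u in lborel. (\<lambda>m. gauss 1 u * \<psi> (s m *\<^sub>R u)) \<longlonglongrightarrow> gauss 1 u * of_real S"
    proof (intro AE_I2 tendsto_mult tendsto_const \<psi>_lim)
      fix u :: "real^'n" show "(\<lambda>m. s m *\<^sub>R u) \<longlonglongrightarrow> 0" using tendsto_scaleR[OF slim, of "\<lambda>_. u" u] by simp
    qed
    show "AE u in lborel. norm (gauss 1 u * \<psi> (s m *\<^sub>R u)) \<le> norm (gauss 1 u) * S" for m
      by (intro AE_I2) (simp only: norm_mult mult_left_mono[OF \<psi>_le norm_ge_zero])
  qed measurable
  have "(LINT u::real^'n|lborel. gauss 1 u) = of_real (sqrt (2 * pi) ^ CARD('n))"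
    using integral_gaussian_iexp[of "0::real^'n"] by simp
  then have "of_real (fourier_const TYPE('n)) * (LINT u::real^'n|lborel. gauss 1 u * of_real S) = 
     complex_of_real (fourier_const TYPE('n) * sqrt (2 * pi) ^ CARD('n) * S)"
    by simp
  then have c: "of_real (fourier_const TYPE('n)) * (LINT u::real^'n|lborel. gauss 1 u * of_real S) = complex_of_real S"
    unfolding fourier_const_sqrt by simp
  define L where "L m = (LINT \<xi>|lborel. (norm (fourier_L1 f \<xi>))\<^sup>2 * exp (- (s m * norm \<xi>)\<^sup>2 / 2))" for m
  have "complex_of_real (L m) = of_real (fourier_const TYPE('n)) * (LINT u|lborel. gauss 1 u * \<psi> (s m *\<^sub>R u))" for m
  proof -
    have "complex_of_real (L m) = (LINT \<xi>|lborel. fourier_L1 f \<xi> * (cnj (fourier_L1 f \<xi>) * gauss (s m) \<xi>))"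
      unfolding L_def integral_complex_of_real[symmetric]
      by (intro Bochner_Integration.integral_cong) (simp_all add: mult.assoc[symmetric] flip: complex_norm_square)
    then show ?thesis by (simp only: plancherel_damped[OF f f2 s] \<psi>_def)
  qed
  then have "(\<lambda>m. complex_of_real (L m)) \<longlonglongrightarrow> of_real S"
    using tendsto_mult[OF tendsto_const[of "of_real (fourier_const TYPE('n))"] lim1] by (simp only: c)
  then have L: "(\<lambda>m. ennreal (L m)) \<longlonglongrightarrow> ennreal S"
    by (simp add: tendsto_of_real_iff)
  have nnL: "(\<integral>\<^sup>+\<xi>. ennreal ((norm (fourier_L1 f \<xi>))\<^sup>2 * exp (- (s m * norm \<xi>)\<^sup>2 / 2)) \<partial>lborel) = ennreal (L m)" for m
    unfolding L_def
  proof (rule nn_integral_eq_integral)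
    define C where "C = fourier_const TYPE('n) * (LINT x|lebesgue. norm (f x))"
    have "(norm (fourier_L1 f \<xi>))\<^sup>2 \<le> C\<^sup>2" for \<xi>
      unfolding C_def by (intro power_mono norm_fourier_L1_le) simp
    then show "integrable lborel (\<lambda>\<xi>. (norm (fourier_L1 f \<xi>))\<^sup>2 * exp (- (s m * norm \<xi>)\<^sup>2 / 2))"
      by (intro Bochner_Integration.integrable_bound[OF integrable_scaleR_right[OF integrable_gauss[OF s[of m]], of "C\<^sup>2"]])
        (auto simp: norm_mult)
  qed simp
  have "(\<lambda>m. \<integral>\<^sup>+\<xi>. ennreal ((norm (fourier_L1 f \<xi>))\<^sup>2 * exp (- (s m * norm \<xi>)\<^sup>2 / 2)) \<partial>lborel) \<longlonglongrightarrow> 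
      (\<integral>\<^sup>+\<xi>. ennreal ((norm (fourier_L1 f \<xi>))\<^sup>2) \<partial>lborel)"
  proof (rule nn_integral_LIMSEQ)
    have "s n \<le> s m" if "m \<le> n" for m n
      using that by (simp add: s_def frac_le)
    then show "incseq (\<lambda>m \<xi>. ennreal ((norm (fourier_L1 f \<xi>))\<^sup>2 * exp (- (s m * norm \<xi>)\<^sup>2 / 2)))"
      using s by (auto simp: incseq_def le_fun_def less_imp_le intro!: ennreal_leI mult_left_mono power_mono mult_right_mono)
    show "(\<lambda>m. ennreal ((norm (fourier_L1 f \<xi>))\<^sup>2 * exp (- (s m * norm \<xi>)\<^sup>2 / 2))) \<longlonglongrightarrow> ennreal ((norm (fourier_L1 f \<xi>))\<^sup>2)" for \<xi>
    proof -
      have "(\<lambda>m. (norm (fourier_L1 f \<xi>))\<^sup>2 * exp (- (s m * norm \<xi>)\<^sup>2 / 2)) \<longlonglongrightarrow> (norm (fourier_L1 f \<xi>))\<^sup>2 * exp (- (0 * norm \<xi>)\<^sup>2 / 2)"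
        by (intro tendsto_intros slim) simp
      then show ?thesis by simp
    qed
  qed measurable
  with L show ?thesis unfolding nnL S_def[symmetric] by (rule LIMSEQ_unique[symmetric])
qed

section \<open>Completeness of L2\<close>

text \<open>The Riesz-Fischer argument: a subsequence with geometrically small increments converges
  almost everywhere, and Fatou's lemma shows that the whole sequence converges to this limit in mean
  square.\<close>

lemma square_integrable_complete:
  fixes F :: "nat \<Rightarrow> 'a \<Rightarrow> complex"
  assumes [measurable]: "\<And>k. F k \<in> borel_measurable M"
    and cauchy: "\<And>e::real. e > 0 \<Longrightarrow> \<exists>N. \<forall>m\<ge>N. \<forall>n\<ge>N. (\<integral>\<^sup>+x. ennreal ((norm (F m x - F n x))\<^sup>2) \<partial>M) \<le> ennreal e"
  obtains g where "g \<in> borel_measurable M" "(\<lambda>k. \<integral>\<^sup>+x. ennreal ((norm (F k x - g x))\<^sup>2) \<partial>M) \<longlonglongrightarrow> 0"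
proof -
  have "\<forall>k::nat. \<exists>N. \<forall>m\<ge>N. \<forall>n\<ge>N. (\<integral>\<^sup>+x. ennreal ((norm (F m x - F n x))\<^sup>2) \<partial>M) \<le> ennreal ((1/4) ^ k)"
    by (intro allI cauchy) simp
  then obtain N where N: "\<And>k m n. m \<ge> N k \<Longrightarrow> n \<ge> N k \<Longrightarrow> (\<integral>\<^sup>+x. ennreal ((norm (F m x - F n x))\<^sup>2) \<partial>M) \<le> ennreal ((1/4) ^ k)"
    by metis
  \<comment> \<open>The partial sums dominate each \<open>N k\<close> and increase; the added
    \<open>k\<close> sends the indices to infinity.\<close>
  define r where "r k = (\<Sum>i\<le>k. N i) + k" for k
  have rN: "N k \<le> r k" for k unfolding r_def by (intro trans_le_add1 member_le_sum) auto
  have rS: "r k \<le> r (Suc k)" for k unfolding r_def by simp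
  have rk: "k \<le> r k" for k unfolding r_def by simp
  define d where "d k x = F (r (Suc k)) x - F (r k) x" for k x
  have [measurable]: "d k \<in> borel_measurable M" for k unfolding d_def by measurable
  have dint: "(\<integral>\<^sup>+x. ennreal ((norm (d k x))\<^sup>2) \<partial>M) \<le> ennreal ((1/4) ^ k)" for k
    unfolding d_def by (intro N) (use rN[of k] rS[of k] in auto)
  \<comment> \<open>The weights \<open>2 ^ k\<close> against the bounds \<open>(1/4) ^ k\<close>
    still give a finite integral. Where the weighted series is finite its terms are bounded, so the
    increments decay like powers of \<open>sqrt (1/2)\<close> and are summable.\<close>
  have "(\<integral>\<^sup>+x. (\<Sum>k. ennreal (2 ^ k * (norm (d k x))\<^sup>2)) \<partial>M) = (\<Sum>k. \<integral>\<^sup>+x. ennreal (2 ^ k * (norm (d k x))\<^sup>2) \<partial>M)"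
    by (rule nn_integral_suminf) measurable
  also have "\<dots> \<le> (\<Sum>k. ennreal ((1/2) ^ k))"
  proof (rule suminf_le)
    fix k
    have "(\<integral>\<^sup>+x. ennreal (2 ^ k * (norm (d k x))\<^sup>2) \<partial>M) = ennreal (2 ^ k) * (\<integral>\<^sup>+x. ennreal ((norm (d k x))\<^sup>2) \<partial>M)"
      by (subst nn_integral_cmult[symmetric]) (auto simp: ennreal_mult)
    also have "\<dots> \<le> ennreal (2 ^ k) * ennreal ((1/4) ^ k)"
      by (intro mult_left_mono dint) simp
    also have "\<dots> = ennreal ((1/2) ^ k)"
      by (simp add: ennreal_mult[symmetric] power_mult_distrib[symmetric])
    finally show "(\<integral>\<^sup>+x. ennreal (2 ^ k * (norm (d k x))\<^sup>2) \<partial>M) \<le> ennreal ((1/2) ^ k)" .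
  qed auto
  also have "\<dots> = ennreal (\<Sum>k. (1/2) ^ k)"
    by (rule suminf_ennreal2) auto
  finally have "(\<integral>\<^sup>+x. (\<Sum>k. ennreal (2 ^ k * (norm (d k x))\<^sup>2)) \<partial>M) \<noteq> \<infinity>"
    by (auto simp: top_unique)
  then have AE1: "AE x in M. (\<Sum>k. ennreal (2 ^ k * (norm (d k x))\<^sup>2)) \<noteq> \<infinity>"
    by (intro nn_integral_PInf_AE) measurable
  define g where "g x = lim (\<lambda>k. F (r k) x)" for x
  have [measurable]: "g \<in> borel_measurable M" unfolding g_def by measurable
  have AE2: "AE x in M. (\<lambda>k. F (r k) x) \<longlonglongrightarrow> g x"
    using AE1
  proof eventually_elim
    fix x assume "(\<Sum>k. ennreal (2 ^ k * (norm (d k x))\<^sup>2)) \<noteq> \<infinity>"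
    then have "summable (\<lambda>k. 2 ^ k * (norm (d k x))\<^sup>2)"
      by (intro summable_suminf_not_top) (auto simp: top_unique)
    then have "(\<lambda>k. 2 ^ k * (norm (d k x))\<^sup>2) \<longlonglongrightarrow> 0" by (rule summable_LIMSEQ_zero)
    then have "Bseq (\<lambda>k. 2 ^ k * (norm (d k x))\<^sup>2)" by (intro convergent_imp_Bseq convergentI)
    then obtain C where C: "C > 0" "\<And>k. norm (2 ^ k * (norm (d k x))\<^sup>2) \<le> C"
      by (auto elim!: BseqE)
    have dle: "norm (d k x) \<le> sqrt C * (sqrt (1/2)) ^ k" for k
    proof -
      have "(norm (d k x))\<^sup>2 \<le> C * (1/2) ^ k"
        using C(2)[of k] by (simp add: field_simps power_one_over)
      then have "sqrt ((norm (d k x))\<^sup>2) \<le> sqrt (C * (1/2) ^ k)" by (rule real_sqrt_le_mono)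
      then show ?thesis by (simp add: real_sqrt_mult real_sqrt_power)
    qed
    have sm: "summable (\<lambda>k. sqrt C * (sqrt (1/2)) ^ k)"
      by (intro summable_mult summable_geometric) (simp add: real_sqrt_lt_1_iff)
    have "summable (\<lambda>k. d k x)"
      by (rule summable_comparison_test'[OF sm]) (rule dle)
    then have "convergent (\<lambda>n. \<Sum>k<n. d k x)" by (simp add: summable_iff_convergent)
    moreover have "(\<Sum>k<n. d k x) = F (r n) x - F (r 0) x" for n
      unfolding d_def by (rule sum_lessThan_telescope)
    ultimately have "convergent (\<lambda>n. F (r n) x - F (r 0) x)" by simp
    then obtain l where "(\<lambda>n. F (r n) x - F (r 0) x) \<longlonglongrightarrow> l" by (auto simp: convergent_def)
    then have "(\<lambda>n. F (r n) x - F (r 0) x + F (r 0) x) \<longlonglongrightarrow> l + F (r 0) x" by (intro tendsto_intros)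
    then show "(\<lambda>k. F (r k) x) \<longlonglongrightarrow> g x"
      unfolding g_def by (simp add: convergent_LIMSEQ_iff[symmetric] convergentI)
  qed
  have "(\<lambda>k. \<integral>\<^sup>+x. ennreal ((norm (F k x - g x))\<^sup>2) \<partial>M) \<longlonglongrightarrow> 0"
  proof (rule order_tendstoI)
    fix a :: ennreal assume "a > 0"
    then obtain b where b: "0 < b" "b < a" using dense by blast
    then obtain e :: real where e: "0 < ennreal e" "ennreal e < a"
      by (cases b) auto
    then obtain n0 where n0: "\<And>m n. m \<ge> n0 \<Longrightarrow> n \<ge> n0 \<Longrightarrow> (\<integral>\<^sup>+x. ennreal ((norm (F m x - F n x))\<^sup>2) \<partial>M) \<le> ennreal e"
      using cauchy[of e] by (auto simp: ennreal_less_zero_iff)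
    show "\<forall>\<^sub>F k in sequentially. (\<integral>\<^sup>+x. ennreal ((norm (F k x - g x))\<^sup>2) \<partial>M) < a"
      unfolding eventually_sequentially
    proof (intro exI[of _ n0] allI impI)
      fix m assume m: "m \<ge> n0"
      \<comment> \<open>With \<open>m\<close> fixed the integrand is a pointwise limit along the
        subsequence, and Fatou's lemma passes the Cauchy bound on to \<open>g\<close>.\<close>
      have "(\<integral>\<^sup>+x. ennreal ((norm (F m x - g x))\<^sup>2) \<partial>M) = 
         (\<integral>\<^sup>+x. liminf (\<lambda>k. ennreal ((norm (F m x - F (r k) x))\<^sup>2)) \<partial>M)"
      proof (rule nn_integral_cong_AE)
        show "AE x in M. ennreal ((norm (F m x - g x))\<^sup>2) = liminf (\<lambda>k. ennreal ((norm (F m x - F (r k) x))\<^sup>2))"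
          using AE2
        proof eventually_elim
          fix x assume "(\<lambda>k. F (r k) x) \<longlonglongrightarrow> g x"
          then have "(\<lambda>k. ennreal ((norm (F m x - F (r k) x))\<^sup>2)) \<longlonglongrightarrow> ennreal ((norm (F m x - g x))\<^sup>2)"
            by (intro tendsto_intros)
          then show "ennreal ((norm (F m x - g x))\<^sup>2) = liminf (\<lambda>k. ennreal ((norm (F m x - F (r k) x))\<^sup>2))"
            by (intro lim_imp_Liminf[symmetric]) auto
        qed
      qed
      also have "\<dots> \<le> liminf (\<lambda>k. \<integral>\<^sup>+x. ennreal ((norm (F m x - F (r k) x))\<^sup>2) \<partial>M)"
        by (rule nn_integral_liminf) measurable
      also have "\<dots> \<le> ennreal e"
      proof (rule Liminf_le)
        show "\<forall>\<^sub>F k in sequentially. (\<integral>\<^sup>+x. ennreal ((norm (F m x - F (r k) x))\<^sup>2) \<partial>M) \<le> ennreal e"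
          unfolding eventually_sequentially using n0[OF m] rk order_trans by blast
      qed simp
      also have "\<dots> < a" by (rule e)
      finally show "(\<integral>\<^sup>+x. ennreal ((norm (F m x - g x))\<^sup>2) \<partial>M) < a" .
    qed
  qed simp
  then show ?thesis by (intro that[of g]) simp_all
qed

section \<open>Square integrable functions\<close>

text \<open>Fubini arguments are carried out for Borel functions, for which composites such as
  \<open>f (x - y)\<close> are jointly measurable; the representative transfers their results to
  Lebesgue measurable functions.\<close>

lemma lebesgue_borel_representative:
  fixes f :: "'a::euclidean_space \<Rightarrow> complex"
  assumes [measurable]: "f \<in> borel_measurable lebesgue"
  obtains f0 where "f0 \<in> borel_measurable borel" "AE x in lebesgue. f x = f0 x"
proof -
  have "(\<lambda>x. Re (f x)) \<in> borel_measurable lebesgue" "(\<lambda>x. Im (f x)) \<in> borel_measurable lebesgue"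
    by measurable
  from this[THEN completion_ex_borel_measurable_real]
  obtain u v where uv: "u \<in> borel_measurable lborel" "v \<in> borel_measurable lborel"
    and ae: "AE x in lborel. Re (f x) = u x" "AE x in lborel. Im (f x) = v x" by blast
  show ?thesis
  proof
    show "(\<lambda>x. Complex (u x) (v x)) \<in> borel_measurable borel"
      using uv unfolding Complex_eq by simp
    from ae have "AE x in lborel. f x = Complex (u x) (v x)"
      by eventually_elim (simp add: complex_eq_iff)
    then show "AE x in lebesgue. f x = Complex (u x) (v x)" by (rule AE_completion)
  qed
qed

lemma borel_measurable_lebesgueI: "f \<in> borel_measurable borel \<Longrightarrow> f \<in> borel_measurable lebesgue"
  by (simp add: measurable_completion)

lemma fourier_L1_cong_AE:
  fixes f g :: "real^'n \<Rightarrow> complex"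
  assumes "f \<in> borel_measurable lebesgue" "g \<in> borel_measurable lebesgue" "AE x in lebesgue. f x = g x"
  shows "fourier_L1 f = fourier_L1 g"
proof
  fix \<xi> :: "real^'n"
  have e: "(\<lambda>x. exp (- \<i> * of_real (x \<bullet> \<xi>))) \<in> borel_measurable lebesgue"
    by (intro borel_measurable_lebesgueI) measurable
  have "(LINT x|lebesgue. f x * exp (- \<i> * of_real (x \<bullet> \<xi>))) = (LINT x|lebesgue. g x * exp (- \<i> * of_real (x \<bullet> \<xi>)))"
    by (intro integral_cong_AE borel_measurable_times assms(1,2) e) (use assms(3) in auto)
  then show "fourier_L1 f \<xi> = fourier_L1 g \<xi>" unfolding fourier_L1_def by simp
qed

text \<open>A change on a null set alters no Fourier integral, so the transforms agree at every
  point and not only almost everywhere.\<close>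

lemma L1_borel_representative:
  assumes "f \<in> L1"
  obtains f0 where "f0 \<in> borel_measurable borel" "AE x in lebesgue. f x = f0 x" "integrable lborel f0"
    "fourier_L1 f = fourier_L1 f0"
proof -
  have f: "integrable lebesgue f" using assms by (simp add: L1_def)
  then have fm: "f \<in> borel_measurable lebesgue" by simp
  obtain f0 where f0: "f0 \<in> borel_measurable borel" "AE x in lebesgue. f x = f0 x"
    using lebesgue_borel_representative[OF fm] .
  have f0m: "f0 \<in> borel_measurable lebesgue" by (rule borel_measurable_lebesgueI[OF f0(1)])
  have "integrable lebesgue f0" using f integrable_cong_AE[OF fm f0m f0(2)] by simp
  then have "integrable lborel f0" using f0(1) by (subst (asm) integrable_completion) auto
  with f0 show ?thesis using fourier_L1_cong_AE[OF fm f0m f0(2)] that by blast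
qed

lemma fourier_L1_mult:
  fixes f g :: "real^'n \<Rightarrow> complex"
  assumes "f \<in> L1" "g \<in> L1"
  shows "(LINT x|lebesgue. fourier_L1 f x * g x) = (LINT x|lebesgue. f x * fourier_L1 g x)"
proof -
  obtain f0 where f0: "f0 \<in> borel_measurable borel" "AE x in lebesgue. f x = f0 x" "integrable lborel f0"
    "fourier_L1 f = fourier_L1 f0" using L1_borel_representative[OF assms(1)] .
  obtain g0 where g0: "g0 \<in> borel_measurable borel" "AE x in lebesgue. g x = g0 x" "integrable lborel g0"
    "fourier_L1 g = fourier_L1 g0" using L1_borel_representative[OF assms(2)] .
  have m: "f \<in> borel_measurable lebesgue" "g \<in> borel_measurable lebesgue" using assms by (auto simp: L1_def)
  note F = fourier_L1_measurable[OF f0(1)] fourier_L1_measurable[OF g0(1)]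
  note L = F[THEN borel_measurable_lebesgueI] f0(1)[THEN borel_measurable_lebesgueI] g0(1)[THEN borel_measurable_lebesgueI]
  have "(LINT x|lebesgue. fourier_L1 f x * g x) = (LINT x|lebesgue. fourier_L1 f0 x * g0 x)"
    unfolding f0(4) by (intro integral_cong_AE borel_measurable_times L m) (use g0(2) in auto)
  also have "\<dots> = (LINT x|lborel. fourier_L1 f0 x * g0 x)"
    by (intro integral_completion borel_measurable_times) (use F g0 in auto)
  also have "\<dots> = (LINT x|lborel. f0 x * fourier_L1 g0 x)"
    by (rule fourier_L1_mult_borel[OF f0(3) g0(3)])
  also have "\<dots> = (LINT x|lebesgue. f0 x * fourier_L1 g0 x)"
    by (intro integral_completion[symmetric] borel_measurable_times) (use F f0 in auto)
  also have "\<dots> = (LINT x|lebesgue. f x * fourier_L1 g x)"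
    unfolding g0(4) by (intro integral_cong_AE borel_measurable_times L m) (use f0(2) in auto)
  finally show ?thesis .
qed

section \<open>Operations and convergence in L2\<close>

lemma L2I: "f \<in> borel_measurable lebesgue \<Longrightarrow> integrable lebesgue (\<lambda>x. (norm (f x))\<^sup>2) \<Longrightarrow> f \<in> L2"
  by (simp add: L2_def)

lemma L2_measurable: "f \<in> L2 \<Longrightarrow> f \<in> borel_measurable lebesgue"
  and L2_square: "f \<in> L2 \<Longrightarrow> integrable lebesgue (\<lambda>x. (norm (f x))\<^sup>2)"
  by (simp_all add: L2_def)

lemma
  fixes f :: "real^'n \<Rightarrow> complex"
  assumes "f \<in> L1 \<inter> L2"
  shows fourier_L1_in_L2: "fourier_L1 f \<in> L2"
    and plancherel_L1_L2: "(LINT x|lebesgue. (norm (fourier_L1 f x))\<^sup>2) = (LINT x|lebesgue. (norm (f x))\<^sup>2)"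
proof -
  obtain f0 where f0: "f0 \<in> borel_measurable borel" "AE x in lebesgue. f x = f0 x" "integrable lborel f0"
    "fourier_L1 f = fourier_L1 f0" using L1_borel_representative assms by blast
  note [measurable] = f0(1) fourier_L1_measurable[OF f0(1)]
  have [measurable]: "f \<in> borel_measurable lebesgue" "f0 \<in> borel_measurable lebesgue"
    using assms L2_measurable borel_measurable_lebesgueI[OF f0(1)] by auto
  have eq: "AE x in lebesgue. (norm (f x))\<^sup>2 = (norm (f0 x))\<^sup>2" using f0(2) by auto
  have "integrable lebesgue (\<lambda>x. (norm (f0 x))\<^sup>2)"
    using assms L2_square integrable_cong_AE[OF _ _ eq] by auto
  then have i0: "integrable lborel (\<lambda>x. (norm (f0 x))\<^sup>2)"
    by (subst (asm) integrable_completion) auto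
  note pl = plancherel_borel[OF f0(3) i0]
  have iF: "integrable lborel (\<lambda>x. (norm (fourier_L1 f x))\<^sup>2)"
    unfolding f0(4) by (rule integrableI_bounded) (simp_all add: pl)
  then show "fourier_L1 f \<in> L2"
    unfolding f0(4) by (intro L2I borel_measurable_lebesgueI) (simp_all add: integrable_completion)
  have "(LINT x|lborel. (norm (fourier_L1 f x))\<^sup>2) = (LINT x|lborel. (norm (f0 x))\<^sup>2)"
    using pl iF unfolding f0(4) by (subst (asm) nn_integral_eq_integral) auto
  also have "\<dots> = (LINT x|lebesgue. (norm (f0 x))\<^sup>2)" by (rule integral_completion[symmetric]) simp
  also have "\<dots> = (LINT x|lebesgue. (norm (f x))\<^sup>2)" using eq by (intro integral_cong_AE) auto
  finally show "(LINT x|lebesgue. (norm (fourier_L1 f x))\<^sup>2) = (LINT x|lebesgue. (norm (f x))\<^sup>2)"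
    unfolding f0(4) by (subst integral_completion) simp_all
qed

lemma norm_add_square_le:
  fixes a b :: "'a::real_normed_vector"
  shows "(norm (a + b))\<^sup>2 \<le> 2 * (norm a)\<^sup>2 + 2 * (norm b)\<^sup>2"
  using power_mono[OF norm_triangle_ineq[of a b] norm_ge_zero, of 2] sum_squares_bound[of "norm a" "norm b"]
  by (simp add: power2_sum)

lemma
  assumes f: "f \<in> L2" and g: "g \<in> L2"
  shows L2_add: "(\<lambda>x. f x + g x) \<in> L2"
    and L2_norm_add_le: "(LINT x|lebesgue. (norm (f x + g x))\<^sup>2) \<le> 
       2 * (LINT x|lebesgue. (norm (f x))\<^sup>2) + 2 * (LINT x|lebesgue. (norm (g x))\<^sup>2)"
proof -
  note [measurable] = L2_measurable[OF f] L2_measurable[OF g]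
  have i: "integrable lebesgue (\<lambda>x. 2 * (norm (f x))\<^sup>2 + 2 * (norm (g x))\<^sup>2)"
    using f g by (simp add: L2_def)
  have j: "integrable lebesgue (\<lambda>x. (norm (f x + g x))\<^sup>2)"
    using i by (rule Bochner_Integration.integrable_bound) (auto intro!: AE_I2 norm_add_square_le)
  show "(\<lambda>x. f x + g x) \<in> L2" by (intro L2I j) simp
  have "(LINT x|lebesgue. (norm (f x + g x))\<^sup>2) \<le> (LINT x|lebesgue. 2 * (norm (f x))\<^sup>2 + 2 * (norm (g x))\<^sup>2)"
    by (intro integral_mono i j norm_add_square_le)
  then show "(LINT x|lebesgue. (norm (f x + g x))\<^sup>2) \<le> 
       2 * (LINT x|lebesgue. (norm (f x))\<^sup>2) + 2 * (LINT x|lebesgue. (norm (g x))\<^sup>2)"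
    using f g by (simp add: L2_def)
qed

lemma L2_cmult: "f \<in> L2 \<Longrightarrow> (\<lambda>x. c * f x) \<in> L2"
  using borel_measurable_times[of "\<lambda>_. c" lebesgue f] by (simp add: L2_def norm_mult power_mult_distrib)

lemma L2_diff: "f \<in> L2 \<Longrightarrow> g \<in> L2 \<Longrightarrow> (\<lambda>x. f x - g x) \<in> L2"
  using L2_add[of f "\<lambda>x. -1 * g x"] L2_cmult[of g "-1"] by simp

lemma L2_cnj: "f \<in> L2 \<Longrightarrow> (\<lambda>x. cnj (f x)) \<in> L2"
  by (simp add: L2_def borel_measurable_cnj)

lemma L2_bounded_mult:
  assumes f: "f \<in> L2" and h: "h \<in> borel_measurable lebesgue" "AE x in lebesgue. norm (h x) \<le> C"
  shows "(\<lambda>x. h x * f x) \<in> L2"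
proof (rule L2I)
  note [measurable] = L2_measurable[OF f] h(1)
  show "(\<lambda>x. h x * f x) \<in> borel_measurable lebesgue" by simp
  show "integrable lebesgue (\<lambda>x. (norm (h x * f x))\<^sup>2)"
  proof (rule Bochner_Integration.integrable_bound)
    show "integrable lebesgue (\<lambda>x. C\<^sup>2 * (norm (f x))\<^sup>2)" using f by (simp add: L2_def)
    show "AE x in lebesgue. norm ((norm (h x * f x))\<^sup>2) \<le> norm (C\<^sup>2 * (norm (f x))\<^sup>2)"
      using h(2) by eventually_elim (simp add: norm_mult power_mult_distrib mult_right_mono power_mono)
  qed simp
qed

lemma L2_cong_AE:
  assumes f: "f \<in> L2" and g: "g \<in> borel_measurable lebesgue" and eq: "AE x in lebesgue. f x = g x"
  shows "g \<in> L2"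
proof -
  note [measurable] = L2_measurable[OF f] g
  have "AE x in lebesgue. (norm (f x))\<^sup>2 = (norm (g x))\<^sup>2" using eq by auto
  then have "integrable lebesgue (\<lambda>x. (norm (g x))\<^sup>2)"
    using L2_square[OF f] integrable_cong_AE[of "\<lambda>x. (norm (f x))\<^sup>2" lebesgue "\<lambda>x. (norm (g x))\<^sup>2"] by simp
  then show ?thesis by (intro L2I g)
qed

lemma
  assumes "f \<in> L2" "g \<in> L2"
  shows L2_mult_L1: "(\<lambda>x. f x * g x) \<in> L1"
    and L2_Cauchy_Schwarz: "norm (LINT x|lebesgue. f x * g x) \<le> 
       sqrt (LINT x|lebesgue. (norm (f x))\<^sup>2) * sqrt (LINT x|lebesgue. (norm (g x))\<^sup>2)"
  using square_integrable_mult[of f lebesgue g] square_integrable_Cauchy_Schwarz[of f lebesgue g] assms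
  by (auto simp: L1_def L2_def)

lemma L2_mult_integrable: "f \<in> L2 \<Longrightarrow> g \<in> L2 \<Longrightarrow> integrable lebesgue (\<lambda>x. f x * g x)"
  using L2_mult_L1 by (simp add: L1_def)

lemma L2_norm_zero_AE:
  assumes f: "f \<in> L2" and "(LINT x|lebesgue. (norm (f x))\<^sup>2) = 0"
  shows "AE x in lebesgue. f x = 0"
  using assms integral_nonneg_eq_0_iff_AE[OF L2_square[OF f]] by simp

lemma L2_tendsto_iff:
  assumes "\<And>k. F k \<in> L2" "f \<in> L2"
  shows "L2_tendsto F f \<longleftrightarrow> (\<lambda>k. LINT x|lebesgue. (norm (F k x - f x))\<^sup>2) \<longlonglongrightarrow> 0"
proof -
  have "(\<integral>\<^sup>+ x. ennreal ((norm (F k x - f x))\<^sup>2) \<partial>lebesgue) = ennreal (LINT x|lebesgue. (norm (F k x - f x))\<^sup>2)" for k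
    using L2_square[OF L2_diff[OF assms(1) assms(2)]] by (intro nn_integral_eq_integral) auto
  then show ?thesis
    unfolding L2_tendsto_def by (simp add: tendsto_ennreal_iff flip: ennreal_0)
qed

text \<open>Because \<open>L2_tendsto\<close> measures distance by an extended integral, convergence
  forces a finite distance to some \<open>F k\<close>, and \<open>g\<close> is then a difference of
  two elements of L2.\<close>

lemma L2_tendsto_in_L2:
  assumes F: "\<And>k. F k \<in> L2" and g: "g \<in> borel_measurable lebesgue" and lim: "L2_tendsto F g"
  shows "g \<in> L2"
proof -
  note [measurable] = g L2_measurable[OF F]
  have "\<forall>\<^sub>F k in sequentially. (\<integral>\<^sup>+ x. ennreal ((norm (F k x - g x))\<^sup>2) \<partial>lebesgue) < 1"
    using lim unfolding L2_tendsto_def by (rule order_tendstoD) simp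
  then obtain k where k: "(\<integral>\<^sup>+ x. ennreal ((norm (F k x - g x))\<^sup>2) \<partial>lebesgue) < 1"
    by (auto simp: eventually_sequentially)
  have "(\<lambda>x. F k x - g x) \<in> L2"
  proof (rule L2I)
    show "integrable lebesgue (\<lambda>x. (norm (F k x - g x))\<^sup>2)"
      using less_trans[OF k] by (intro integrableI_bounded) simp_all
  qed simp
  from L2_diff[OF F[of k] this] show ?thesis by simp
qed

text \<open>The difference of the products is split as
  \<open>(F - f) (G - g) + (F - f) g + f (G - g)\<close>, and the Cauchy-Schwarz inequality is
  applied to each term.\<close>

lemma L2_tendsto_inner:
  assumes F: "\<And>k. F k \<in> L2" "f \<in> L2" "L2_tendsto F f" and G: "\<And>k. G k \<in> L2" "g \<in> L2" "L2_tendsto G g"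
  shows "(\<lambda>k. LINT x|lebesgue. F k x * G k x) \<longlonglongrightarrow> (LINT x|lebesgue. f x * g x)"
proof -
  let ?N = "\<lambda>f. LINT x|lebesgue. (norm (f x))\<^sup>2"
  have f: "(\<lambda>k. ?N (\<lambda>x. F k x - f x)) \<longlonglongrightarrow> 0" using F by (simp add: L2_tendsto_iff)
  have g: "(\<lambda>k. ?N (\<lambda>x. G k x - g x)) \<longlonglongrightarrow> 0" using G by (simp add: L2_tendsto_iff)
  note dF = L2_diff[OF F(1,2)] note dG = L2_diff[OF G(1,2)]
  let ?B = "\<lambda>k. sqrt (?N (\<lambda>x. F k x - f x)) * sqrt (?N (\<lambda>x. G k x - g x)) + 
     sqrt (?N (\<lambda>x. F k x - f x)) * sqrt (?N g) + sqrt (?N f) * sqrt (?N (\<lambda>x. G k x - g x))"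
  have "(\<lambda>k. ?B k) \<longlonglongrightarrow> sqrt 0 * sqrt 0 + sqrt 0 * sqrt (?N g) + sqrt (?N f) * sqrt 0"
    by (intro tendsto_intros f g)
  then have B: "?B \<longlonglongrightarrow> 0" by simp
  have "(\<lambda>k. (LINT x|lebesgue. F k x * G k x) - (LINT x|lebesgue. f x * g x)) \<longlonglongrightarrow> 0"
  proof (rule Lim_null_comparison[OF _ B], intro always_eventually allI)
    fix k
    have "(LINT x|lebesgue. F k x * G k x) - (LINT x|lebesgue. f x * g x) = 
      (LINT x|lebesgue. F k x * G k x - f x * g x)"
      using L2_mult_integrable[OF F(1) G(1)] L2_mult_integrable[OF F(2) G(2)] by simp
    also have "\<dots> = (LINT x|lebesgue. ((F k x - f x) * (G k x - g x) + (F k x - f x) * g x) + f x * (G k x - g x))"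
      by (intro Bochner_Integration.integral_cong) (simp_all add: algebra_simps)
    also have "\<dots> = (LINT x|lebesgue. (F k x - f x) * (G k x - g x)) + (LINT x|lebesgue. (F k x - f x) * g x)
       + (LINT x|lebesgue. f x * (G k x - g x))"
      using L2_mult_integrable[OF dF dG] L2_mult_integrable[OF dF G(2)] L2_mult_integrable[OF F(2) dG]
      by (subst Bochner_Integration.integral_add Bochner_Integration.integrable_add; simp)+
    finally have "norm ((LINT x|lebesgue. F k x * G k x) - (LINT x|lebesgue. f x * g x)) \<le> 
      norm (LINT x|lebesgue. (F k x - f x) * (G k x - g x)) + norm (LINT x|lebesgue. (F k x - f x) * g x)
       + norm (LINT x|lebesgue. f x * (G k x - g x))"
      by (metis (no_types, lifting) norm_triangle_ineq norm_triangle_mono order_refl)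
    also have "\<dots> \<le> ?B k"
      by (intro add_mono L2_Cauchy_Schwarz dF dG F G)
    finally show "norm ((LINT x|lebesgue. F k x * G k x) - (LINT x|lebesgue. f x * g x)) \<le> ?B k" .
  qed
  then show ?thesis by (simp add: LIM_zero_iff)
qed

lemma L2_tendsto_lincomb:
  assumes F: "\<And>k. F k \<in> L2" "f \<in> L2" "L2_tendsto F f" and G: "\<And>k. G k \<in> L2" "g \<in> L2" "L2_tendsto G g"
  shows "L2_tendsto (\<lambda>k x. F k x + c * G k x) (\<lambda>x. f x + c * g x)"
proof -
  let ?N = "\<lambda>f. LINT x|lebesgue. (norm (f x))\<^sup>2"
  have f: "(\<lambda>k. ?N (\<lambda>x. F k x - f x)) \<longlonglongrightarrow> 0" using F by (simp add: L2_tendsto_iff)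
  have g: "(\<lambda>k. ?N (\<lambda>x. G k x - g x)) \<longlonglongrightarrow> 0" using G by (simp add: L2_tendsto_iff)
  note dF = L2_diff[OF F(1,2)] note dG = L2_cmult[OF L2_diff[OF G(1,2)], of c]
  have "(\<lambda>k. 2 * ?N (\<lambda>x. F k x - f x) + 2 * ((norm c)\<^sup>2 * ?N (\<lambda>x. G k x - g x))) \<longlonglongrightarrow> 2 * 0 + 2 * ((norm c)\<^sup>2 * 0)"
    by (intro tendsto_intros f g)
  then have B: "(\<lambda>k. 2 * ?N (\<lambda>x. F k x - f x) + 2 * ((norm c)\<^sup>2 * ?N (\<lambda>x. G k x - g x))) \<longlonglongrightarrow> 0" by simp
  have "(\<lambda>k. ?N (\<lambda>x. (F k x + c * G k x) - (f x + c * g x))) \<longlonglongrightarrow> 0"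
  proof (rule Lim_null_comparison[OF _ B], intro always_eventually allI)
    fix k
    have "?N (\<lambda>x. (F k x + c * G k x) - (f x + c * g x)) = ?N (\<lambda>x. (F k x - f x) + c * (G k x - g x))"
      by (simp add: algebra_simps)
    also have "\<dots> \<le> 2 * ?N (\<lambda>x. F k x - f x) + 2 * ?N (\<lambda>x. c * (G k x - g x))"
      by (rule L2_norm_add_le[OF dF dG])
    finally show "norm (?N (\<lambda>x. (F k x + c * G k x) - (f x + c * g x))) \<le> 
      2 * ?N (\<lambda>x. F k x - f x) + 2 * ((norm c)\<^sup>2 * ?N (\<lambda>x. G k x - g x))"
      by (simp add: norm_mult power_mult_distrib)
  qed
  then show ?thesis using F G by (subst L2_tendsto_iff) (auto intro!: L2_add L2_cmult)
qed

lemma L1_lincomb: "f \<in> L1 \<Longrightarrow> g \<in> L1 \<Longrightarrow> (\<lambda>x. f x + c * g x) \<in> L1"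
  by (simp add: L1_def)

lemma fourier_L1_lincomb:
  assumes "f \<in> L1" "g \<in> L1"
  shows "fourier_L1 (\<lambda>x. f x + c * g x) \<xi> = fourier_L1 f \<xi> + c * fourier_L1 g \<xi>"
proof -
  have "integrable lebesgue (\<lambda>x. f x * exp (- \<i> * of_real (x \<bullet> \<xi>)))" "integrable lebesgue (\<lambda>x. g x * exp (- \<i> * of_real (x \<bullet> \<xi>)))"
    using assms by (auto simp only: L1_def mem_Collect_eq intro!: integrable_fourier_kernel)
  then show ?thesis unfolding fourier_L1_def
    by (simp add: ring_distribs mult.assoc)
qed

section \<open>Polarisation and Parseval's identity\<close>

text \<open>Polarisation: the squared norm of \<open>f + c g\<close> contains the cross term
  \<open>2 Re (cnj c * I)\<close>, with \<open>I\<close> the inner product. Comparing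
  \<open>c = 1\<close> with \<open>c = -1\<close> isolates the real part of \<open>I\<close>,
  comparing \<open>\<i>\<close> with \<open>-\<i>\<close> its imaginary part.\<close>

lemma L2_inner_eqI:
  fixes f f' g g' :: "real^'n \<Rightarrow> complex"
  assumes f: "f \<in> L2" "f' \<in> L2" and g: "g \<in> L2" "g' \<in> L2"
    and eq: "\<And>c. (LINT x|lebesgue. (norm (f x + c * g x))\<^sup>2) = (LINT x|lebesgue. (norm (f' x + c * g' x))\<^sup>2)"
  shows "(LINT x|lebesgue. f x * cnj (g x)) = (LINT x|lebesgue. f' x * cnj (g' x))"
proof -
  let ?N = "\<lambda>f. LINT x|lebesgue. (norm (f x))\<^sup>2"
  have pol: "?N (\<lambda>x. a x + c * b x) = ?N a + (norm c)\<^sup>2 * ?N b + 2 * Re (cnj c * (LINT x|lebesgue. a x * cnj (b x)))"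
    if a: "a \<in> L2" and b: "b \<in> L2" for a b :: "real^'n \<Rightarrow> complex" and c
  proof -
    have i: "integrable lebesgue (\<lambda>x. cnj c * (a x * cnj (b x)))"
      using L2_mult_integrable[OF a L2_cnj[OF b]] by simp
    have "(norm (a x + c * b x))\<^sup>2 = (norm (a x))\<^sup>2 + (norm c)\<^sup>2 * (norm (b x))\<^sup>2 + 2 * Re (cnj c * (a x * cnj (b x)))" for x
      unfolding cmod_power2 by (simp add: power2_eq_square algebra_simps)
    then have "?N (\<lambda>x. a x + c * b x) = (LINT x|lebesgue. ((norm (a x))\<^sup>2 + (norm c)\<^sup>2 * (norm (b x))\<^sup>2) + 2 * Re (cnj c * (a x * cnj (b x))))"
      by simp
    also have "\<dots> = (LINT x|lebesgue. (norm (a x))\<^sup>2 + (norm c)\<^sup>2 * (norm (b x))\<^sup>2) + (LINT x|lebesgue. 2 * Re (cnj c * (a x * cnj (b x))))"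
      using L2_square[OF a] L2_square[OF b] integrable_Re[OF i]
      by (intro Bochner_Integration.integral_add Bochner_Integration.integrable_add integrable_mult_right)
    also have "(LINT x|lebesgue. 2 * Re (cnj c * (a x * cnj (b x)))) = 2 * Re (LINT x|lebesgue. cnj c * (a x * cnj (b x)))"
      using integral_Re[OF i] by (simp only: integral_mult_right_zero)
    also have "(LINT x|lebesgue. cnj c * (a x * cnj (b x))) = cnj c * (LINT x|lebesgue. a x * cnj (b x))"
      by (rule integral_mult_right_zero)
    also have "(LINT x|lebesgue. (norm (a x))\<^sup>2 + (norm c)\<^sup>2 * (norm (b x))\<^sup>2) = ?N a + (norm c)\<^sup>2 * ?N b"
      using L2_square[OF a] L2_square[OF b] by simp
    finally show ?thesis .
  qed
  have e0: "?N f = ?N f'" using eq[of 0] by simp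
  have e: "(norm c)\<^sup>2 * ?N g + 2 * Re (cnj c * (LINT x|lebesgue. f x * cnj (g x))) = 
     (norm c)\<^sup>2 * ?N g' + 2 * Re (cnj c * (LINT x|lebesgue. f' x * cnj (g' x)))" for c
    using eq[of c] e0 by (simp only: pol[OF f(1) g(1)] pol[OF f(2) g(2)] add.assoc add_left_cancel)
  show ?thesis
    using e[of 1] e[of "-1"] e[of \<i>] e[of "-\<i>"] by (simp add: complex_eq_iff)
qed

lemma parseval_L1_L2:
  fixes f g :: "real^'n \<Rightarrow> complex"
  assumes f: "f \<in> L1 \<inter> L2" and g: "g \<in> L1 \<inter> L2"
  shows "(LINT x|lebesgue. fourier_L1 f x * cnj (fourier_L1 g x)) = (LINT x|lebesgue. f x * cnj (g x))"
proof (rule L2_inner_eqI)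
  fix c
  have "(\<lambda>x. f x + c * g x) \<in> L1 \<inter> L2" using f g by (auto intro: L1_lincomb L2_add L2_cmult)
  from plancherel_L1_L2[OF this]
  show "(LINT x|lebesgue. (norm (fourier_L1 f x + c * fourier_L1 g x))\<^sup>2) = (LINT x|lebesgue. (norm (f x + c * g x))\<^sup>2)"
    using f g by (simp add: fourier_L1_lincomb)
qed (use f g fourier_L1_in_L2 in auto)

section \<open>The Fourier transform of square integrable functions\<close>

text \<open>Convolutions and inversion substitute \<open>t - x\<close> into functions that are
  merely Lebesgue measurable, so the reflection has to be measurable between the completed
  sigma-algebras.\<close>

lemma
  fixes t :: "'a::euclidean_space"
  shows distr_lebesgue_reflect: "distr lebesgue lebesgue (\<lambda>x. t - x) = lebesgue"
    and measurable_lebesgue_reflect: "(\<lambda>x. t - x) \<in> lebesgue \<rightarrow>\<^sub>M lebesgue"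
proof -
  have T: "t + (\<Sum>j\<in>Basis. ((-1) * (x \<bullet> j)) *\<^sub>R j) = t - x" for x :: 'a
    by (simp add: sum_negf euclidean_representation)
  have "lebesgue = density (distr lebesgue lebesgue (\<lambda>x. t - x)) (\<lambda>_. ennreal (\<Prod>j\<in>(Basis::'a set). \<bar>-1::real\<bar>))"
    using lebesgue_affine_euclidean[of "\<lambda>_. -1" t] unfolding T by simp
  then show "distr lebesgue lebesgue (\<lambda>x. t - x) = lebesgue" by (simp add: density_1)
  show "(\<lambda>x. t - x) \<in> lebesgue \<rightarrow>\<^sub>M lebesgue"
    using lebesgue_affine_measurable[of "\<lambda>_. -1" t] unfolding T by simp
qed

lemma borel_measurable_reflect:
  fixes t :: "'a::euclidean_space"
  shows "f \<in> borel_measurable lebesgue \<Longrightarrow> (\<lambda>x. f (t - x)) \<in> borel_measurable lebesgue"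
  by (rule measurable_compose[OF measurable_lebesgue_reflect])

lemma integral_reflect:
  fixes f :: "'a::euclidean_space \<Rightarrow> 'b::{banach,second_countable_topology}"
  assumes "f \<in> borel_measurable lebesgue"
  shows "(LINT x|lebesgue. f (t - x)) = (LINT x|lebesgue. f x)"
  using integral_distr[OF measurable_lebesgue_reflect[of t] assms] by (simp add: distr_lebesgue_reflect)

lemma integrable_reflect:
  fixes f :: "'a::euclidean_space \<Rightarrow> 'b::{banach,second_countable_topology}"
  assumes "integrable lebesgue f"
  shows "integrable lebesgue (\<lambda>x. f (t - x))"
  using assms integrable_distr_eq[OF measurable_lebesgue_reflect[of t], of f] by (simp add: distr_lebesgue_reflect)

lemma AE_reflect:
  fixes t :: "'a::euclidean_space"
  assumes "AE x in lebesgue. P x"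
  shows "AE x in lebesgue. P (t - x)"
proof -
  have "AE x in distr lebesgue lebesgue (\<lambda>x. t - x). P x" using assms by (subst distr_lebesgue_reflect)
  then show ?thesis by (rule AE_distrD[OF measurable_lebesgue_reflect])
qed

lemma L1_reflect: "f \<in> L1 \<Longrightarrow> (\<lambda>x. f (t - x)) \<in> L1"
  by (simp add: L1_def integrable_reflect)

lemma L2_reflect: "f \<in> L2 \<Longrightarrow> (\<lambda>x. f (t - x)) \<in> L2"
  by (simp add: L2_def borel_measurable_reflect integrable_reflect[of "\<lambda>x. (norm (f x))\<^sup>2"])

lemma L2_tendsto_reflect:
  assumes "\<And>k. F k \<in> L2" "f \<in> L2" "L2_tendsto F f"
  shows "L2_tendsto (\<lambda>k x. F k (t - x)) (\<lambda>x. f (t - x))"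
proof -
  have m: "(\<lambda>x. (norm (F k x - f x))\<^sup>2) \<in> borel_measurable lebesgue" for k
    using L2_square[OF L2_diff[OF assms(1,2)]] by simp
  show ?thesis
    using assms integral_reflect[OF m, where t=t] by (simp add: L2_tendsto_iff L2_reflect)
qed

section \<open>Isometry, uniqueness and existence of the L2 transform\<close>

text \<open>Plancherel's identity puts the approximating transforms into L2. Recording this in the
  unfolded form makes it available to every limit argument below.\<close>

lemma is_fourier_L2_iff:
  fixes f g :: "real^'a \<Rightarrow> complex"
  shows "is_fourier_L2 f g \<longleftrightarrow> f \<in> L2 \<and> g \<in> L2 \<and> 
     (\<exists>F. (\<forall>k. F k \<in> L1 \<and> F k \<in> L2 \<and> fourier_L1 (F k) \<in> L2) \<and> L2_tendsto F f \<and> L2_tendsto (\<lambda>k. fourier_L1 (F k)) g)"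
proof -
  have "(\<forall>k. F k \<in> L1 \<inter> L2) \<longleftrightarrow> (\<forall>k. F k \<in> L1 \<and> F k \<in> L2 \<and> fourier_L1 (F k) \<in> L2)" 
    for F :: "nat \<Rightarrow> real^'a \<Rightarrow> complex"
    by (auto intro: fourier_L1_in_L2)
  then show ?thesis unfolding is_fourier_L2_def by (simp only:)
qed

lemma is_fourier_L2_in_L2: 
  assumes "is_fourier_L2 f g"
  shows "f \<in> L2" "g \<in> L2"
  using assms by (auto simp: is_fourier_L2_def)

lemma is_fourier_L2_lincomb:
  assumes "is_fourier_L2 f f'" "is_fourier_L2 g g'"
  shows "is_fourier_L2 (\<lambda>x. f x + c * g x) (\<lambda>x. f' x + c * g' x)"
proof -
  obtain F where F: "f \<in> L2" "f' \<in> L2" "\<And>k. F k \<in> L1" "\<And>k. F k \<in> L2" "\<And>k. fourier_L1 (F k) \<in> L2" 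
    "L2_tendsto F f" "L2_tendsto (\<lambda>k. fourier_L1 (F k)) f'" using assms(1) unfolding is_fourier_L2_iff by auto
  obtain G where G: "g \<in> L2" "g' \<in> L2" "\<And>k. G k \<in> L1" "\<And>k. G k \<in> L2" "\<And>k. fourier_L1 (G k) \<in> L2" 
    "L2_tendsto G g" "L2_tendsto (\<lambda>k. fourier_L1 (G k)) g'" using assms(2) unfolding is_fourier_L2_iff by auto
  have e: "fourier_L1 (\<lambda>x. F k x + c * G k x) = (\<lambda>\<xi>. fourier_L1 (F k) \<xi> + c * fourier_L1 (G k) \<xi>)" for k
    by (intro ext fourier_L1_lincomb F G)
  show ?thesis
    unfolding is_fourier_L2_iff
    by (intro conjI exI[of _ "\<lambda>k x. F k x + c * G k x"] allI; (unfold e)?)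
      (rule L2_add L2_cmult L1_lincomb L2_tendsto_lincomb F G)+
qed

lemma is_fourier_L2_L1:
  assumes "f \<in> L1 \<inter> L2"
  shows "is_fourier_L2 f (fourier_L1 f)"
  unfolding is_fourier_L2_def
proof (intro conjI exI[of _ "\<lambda>_. f"] allI)
  show "fourier_L1 f \<in> L2" by (rule fourier_L1_in_L2[OF assms])
qed (use assms in \<open>simp_all add: L2_tendsto_def\<close>)

lemma is_fourier_L2_parseval:
  assumes "is_fourier_L2 f f'" "is_fourier_L2 g g'"
  shows "(LINT x|lebesgue. f' x * cnj (g' x)) = (LINT x|lebesgue. f x * cnj (g x))"
proof -
  obtain F where F: "f \<in> L2" "f' \<in> L2" "\<And>k. F k \<in> L1" "\<And>k. F k \<in> L2" "\<And>k. fourier_L1 (F k) \<in> L2" 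
    "L2_tendsto F f" "L2_tendsto (\<lambda>k. fourier_L1 (F k)) f'" using assms(1) unfolding is_fourier_L2_iff by auto
  obtain G where G: "g \<in> L2" "g' \<in> L2" "\<And>k. G k \<in> L1" "\<And>k. G k \<in> L2" "\<And>k. fourier_L1 (G k) \<in> L2" 
    "L2_tendsto G g" "L2_tendsto (\<lambda>k. fourier_L1 (G k)) g'" using assms(2) unfolding is_fourier_L2_iff by auto
  have c: "L2_tendsto (\<lambda>k x. cnj (H k x)) (\<lambda>x. cnj (h x))" if "L2_tendsto H h" for H h
    using that unfolding L2_tendsto_def by (simp flip: complex_cnj_diff)
  have "(\<lambda>k. LINT x|lebesgue. fourier_L1 (F k) x * cnj (fourier_L1 (G k) x)) \<longlonglongrightarrow> (LINT x|lebesgue. f' x * cnj (g' x))"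
    by (intro L2_tendsto_inner c L2_cnj F G)
  moreover have "(LINT x|lebesgue. fourier_L1 (F k) x * cnj (fourier_L1 (G k) x)) = (LINT x|lebesgue. F k x * cnj (G k x))" for k
    by (intro parseval_L1_L2) (use F G in auto)
  ultimately have "(\<lambda>k. LINT x|lebesgue. F k x * cnj (G k x)) \<longlonglongrightarrow> (LINT x|lebesgue. f' x * cnj (g' x))"
    by (simp only:)
  moreover have "(\<lambda>k. LINT x|lebesgue. F k x * cnj (G k x)) \<longlonglongrightarrow> (LINT x|lebesgue. f x * cnj (g x))"
    by (intro L2_tendsto_inner c L2_cnj F G)
  ultimately show ?thesis by (rule LIMSEQ_unique)
qed

lemma is_fourier_L2_norm:
  assumes "is_fourier_L2 f g"
  shows "(LINT x|lebesgue. (norm (g x))\<^sup>2) = (LINT x|lebesgue. (norm (f x))\<^sup>2)"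
proof -
  have "complex_of_real (LINT x|lebesgue. (norm (h x))\<^sup>2) = (LINT x|lebesgue. h x * cnj (h x))" for h :: "real^'a \<Rightarrow> complex"
    unfolding complex_norm_square[symmetric] by (rule integral_complex_of_real[symmetric])
  then show ?thesis using is_fourier_L2_parseval[OF assms assms] of_real_eq_iff by metis
qed

text \<open>The isometry applied to the difference. From right to left this is uniqueness of the
  transform; from left to right it is injectivity, by which identities are verified on the Fourier
  side.\<close>

lemma is_fourier_L2_AE_eq_iff:
  assumes "is_fourier_L2 f f'" "is_fourier_L2 g g'"
  shows "(AE x in lebesgue. f' x = g' x) \<longleftrightarrow> (AE x in lebesgue. f x = g x)"
proof -
  let ?N = "\<lambda>f. LINT x|lebesgue. (norm (f x))\<^sup>2"
  have z: "(AE x in lebesgue. a x = b x) \<longleftrightarrow> ?N (\<lambda>x. a x + (-1) * b x) = 0" if "a \<in> L2" "b \<in> L2" for a b :: "real^'a \<Rightarrow> complex"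
  proof -
    note i = L2_square[OF L2_add[OF that(1) L2_cmult[OF that(2)]], of "-1"]
    show ?thesis using integral_nonneg_eq_0_iff_AE[OF i] by simp
  qed
  show ?thesis
    using is_fourier_L2_norm[OF is_fourier_L2_lincomb[OF assms, of "-1"]] assms
    by (simp only: z is_fourier_L2_in_L2[OF assms(1)] is_fourier_L2_in_L2[OF assms(2)])
qed

lemma is_fourier_L2_cong_AE:
  assumes P: "is_fourier_L2 f g" and f': "f' \<in> borel_measurable lebesgue" "AE x in lebesgue. f x = f' x"
    and g': "g' \<in> borel_measurable lebesgue" "AE x in lebesgue. g x = g' x"
  shows "is_fourier_L2 f' g'"
proof -
  have t: "L2_tendsto F u'" if "L2_tendsto F u" and ae: "AE x in lebesgue. u x = u' x" for F u u'
  proof -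
    have "(\<integral>\<^sup>+ x. ennreal ((norm (F k x - u x))\<^sup>2) \<partial>lebesgue) = (\<integral>\<^sup>+ x. ennreal ((norm (F k x - u' x))\<^sup>2) \<partial>lebesgue)" for k
      using ae by (intro nn_integral_cong_AE) auto
    with that(1) show ?thesis unfolding L2_tendsto_def by simp
  qed
  show ?thesis
    using P t f'(2) g'(2) L2_cong_AE[OF _ f'] L2_cong_AE[OF _ g'] unfolding is_fourier_L2_def by metis
qed

text \<open>The truncations of \<open>f\<close> to balls lie in L1 and L2 and tend to
  \<open>f\<close>. By the isometry their transforms form a Cauchy sequence, and completeness
  supplies the limit.\<close>

lemma is_fourier_L2_exists:
  fixes f :: "real^'n \<Rightarrow> complex"
  assumes f: "f \<in> L2"
  shows "\<exists>g. is_fourier_L2 f g"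
proof -
  let ?N = "\<lambda>f. LINT x|lebesgue. (norm (f x))\<^sup>2"
  note [measurable] = L2_measurable[OF f]
  define F where "F k x = indicator (cball 0 (real k)) x * f x" for k :: nat and x
  have ind: "(indicator (cball 0 r) :: real^'n \<Rightarrow> complex) \<in> L2" for r
  proof (rule L2I)
    have "(\<lambda>x::real^'n. (norm (indicator (cball 0 r) x :: complex))\<^sup>2) = indicator (cball 0 r)"
      by (auto simp: fun_eq_iff indicator_def)
    moreover have "emeasure lebesgue (cball (0::real^'n) r) < \<infinity>"
      using emeasure_bounded_finite[OF bounded_cball] by simp
    ultimately show "integrable lebesgue (\<lambda>x::real^'n. (norm (indicator (cball 0 r) x :: complex))\<^sup>2)"
      by (simp add: integrable_indicator_iff)
  qed (rule borel_measurable_indicator, simp)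
  have FL: "F k \<in> L1" "F k \<in> L2" for k
  proof -
    show "F k \<in> L1" unfolding F_def by (rule L2_mult_L1[OF ind f])
    show "F k \<in> L2" unfolding F_def
    proof (rule L2_bounded_mult[OF f, of _ 1])
      show "(indicator (cball 0 (real k)) :: real^'n \<Rightarrow> complex) \<in> borel_measurable lebesgue"
        by (rule borel_measurable_indicator) simp
    qed (simp add: indicator_def)
  qed
  have "(\<lambda>k. ?N (\<lambda>x. F k x - f x)) \<longlonglongrightarrow> (LINT x::real^'n|lebesgue. 0)"
  proof (rule integral_dominated_convergence[where w="\<lambda>x. (norm (f x))\<^sup>2"])
    show "AE x in lebesgue. (\<lambda>k. (norm (F k x - f x))\<^sup>2) \<longlonglongrightarrow> 0"
    proof (rule AE_I2)
      fix x :: "real^'n"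
      obtain k0 :: nat where "norm x \<le> real k0" using real_arch_simple by blast
      then have "\<forall>\<^sub>F k in sequentially. (norm (F k x - f x))\<^sup>2 = 0"
        unfolding eventually_sequentially by (intro exI[of _ k0]) (auto simp: F_def)
      then show "(\<lambda>k. (norm (F k x - f x))\<^sup>2) \<longlonglongrightarrow> 0" by (rule tendsto_eventually)
    qed
    show "AE x in lebesgue. norm ((norm (F k x - f x))\<^sup>2) \<le> (norm (f x))\<^sup>2" for k
      by (rule AE_I2) (simp add: F_def indicator_def)
  qed (use L2_square[OF f] L2_measurable[OF FL(2)] in auto)
  then have lim: "(\<lambda>k. ?N (\<lambda>x. F k x - f x)) \<longlonglongrightarrow> 0" by simp
  have FF: "fourier_L1 (F k) \<in> L2" for k using FL by (intro fourier_L1_in_L2) auto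
  have diff: "?N (\<lambda>x. fourier_L1 (F m) x - fourier_L1 (F n) x) \<le> 2 * ?N (\<lambda>x. F m x - f x) + 2 * ?N (\<lambda>x. F n x - f x)" for m n
  proof -
    have "?N (\<lambda>x. fourier_L1 (F m) x + (-1) * fourier_L1 (F n) x) = ?N (\<lambda>x. F m x + (-1) * F n x)"
      by (intro is_fourier_L2_norm is_fourier_L2_lincomb is_fourier_L2_L1) (use FL in auto)
    also have "\<dots> = ?N (\<lambda>x. (F m x - f x) + (-1) * (F n x - f x))" by simp
    also have "\<dots> \<le> 2 * ?N (\<lambda>x. F m x - f x) + 2 * ?N (\<lambda>x. (-1) * (F n x - f x))"
      by (intro L2_norm_add_le L2_cmult L2_diff FL f)
    finally show ?thesis by (simp add: norm_minus_commute)
  qed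
  obtain g where g: "g \<in> borel_measurable lebesgue" 
    "(\<lambda>k. \<integral>\<^sup>+x. ennreal ((norm (fourier_L1 (F k) x - g x))\<^sup>2) \<partial>lebesgue) \<longlonglongrightarrow> 0"
  proof (rule square_integrable_complete)
    show "fourier_L1 (F k) \<in> borel_measurable lebesgue" for k by (rule L2_measurable[OF FF])
    fix e :: real assume "e > 0"
    then obtain N where N: "\<And>k. k \<ge> N \<Longrightarrow> ?N (\<lambda>x. F k x - f x) < e / 4"
      using LIMSEQ_D[OF lim, of "e/4"] by auto
    show "\<exists>N. \<forall>m\<ge>N. \<forall>n\<ge>N. (\<integral>\<^sup>+x. ennreal ((norm (fourier_L1 (F m) x - fourier_L1 (F n) x))\<^sup>2) \<partial>lebesgue) \<le> ennreal e"
    proof (intro exI[of _ N] allI impI)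
      fix m n assume "m \<ge> N" "n \<ge> N"
      then have "?N (\<lambda>x. fourier_L1 (F m) x - fourier_L1 (F n) x) \<le> e"
        using diff[of m n] N[of m] N[of n] by simp
      then show "(\<integral>\<^sup>+x. ennreal ((norm (fourier_L1 (F m) x - fourier_L1 (F n) x))\<^sup>2) \<partial>lebesgue) \<le> ennreal e"
        using L2_square[OF L2_diff[OF FF FF]] by (subst nn_integral_eq_integral) (auto intro: ennreal_leI)
    qed
  qed (rule that)
  have gt: "L2_tendsto (\<lambda>k. fourier_L1 (F k)) g" using g(2) by (simp add: L2_tendsto_def)
  have "g \<in> L2" by (rule L2_tendsto_in_L2[OF FF g(1) gt])
  moreover have "L2_tendsto F f" using lim FL f by (subst L2_tendsto_iff) auto
  ultimately have "is_fourier_L2 f g" unfolding is_fourier_L2_def using f FL gt by auto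
  then show ?thesis by blast
qed

section \<open>Reflection, modulation and inversion\<close>

lemma is_fourier_L2_reflect:
  assumes "is_fourier_L2 f g"
  shows "is_fourier_L2 (\<lambda>x. f (- x)) (\<lambda>x. g (- x))"
proof -
  obtain F where F: "f \<in> L2" "g \<in> L2" "\<And>k. F k \<in> L1" "\<And>k. F k \<in> L2" "\<And>k. fourier_L1 (F k) \<in> L2" 
    "L2_tendsto F f" "L2_tendsto (\<lambda>k. fourier_L1 (F k)) g" using assms unfolding is_fourier_L2_iff by auto
  have e: "fourier_L1 (\<lambda>x. F k (0 - x)) = (\<lambda>\<xi>. fourier_L1 (F k) (0 - \<xi>))" for k
  proof
    fix \<xi>
    have "integrable lebesgue (\<lambda>x. F k x * exp (- \<i> * of_real (x \<bullet> (0 - \<xi>))))"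
      by (intro integrable_fourier_kernel) (use F(3)[of k] in \<open>auto simp: L1_def\<close>)
    from integral_reflect[OF borel_measurable_integrable[OF this], of 0]
    show "fourier_L1 (\<lambda>x. F k (0 - x)) \<xi> = fourier_L1 (F k) (0 - \<xi>)"
      by (simp add: fourier_L1_def)
  qed
  have "is_fourier_L2 (\<lambda>x. f (0 - x)) (\<lambda>x. g (0 - x))"
    unfolding is_fourier_L2_iff
  proof (intro conjI exI[of _ "\<lambda>k x. F k (0 - x)"] allI; (unfold e)?)
    show "L2_tendsto (\<lambda>k x. F k (0 - x)) (\<lambda>x. f (0 - x))" by (rule L2_tendsto_reflect[OF F(4,1,6)])
    show "L2_tendsto (\<lambda>k x. fourier_L1 (F k) (0 - x)) (\<lambda>x. g (0 - x))" by (rule L2_tendsto_reflect[OF F(5,2,7)])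
  qed (rule L2_reflect L1_reflect, rule F)+
  then show ?thesis by simp
qed

lemma L2_modulate_cnj:
  fixes f :: "real^'n \<Rightarrow> complex"
  assumes "f \<in> L2"
  shows "(\<lambda>x. exp (\<i> * of_real (x \<bullet> \<xi>)) * cnj (f x)) \<in> L2"
proof (rule L2_bounded_mult[OF L2_cnj[OF assms], of _ 1])
  show "(\<lambda>x::real^'n. exp (\<i> * complex_of_real (x \<bullet> \<xi>))) \<in> borel_measurable lebesgue"
    by (intro borel_measurable_lebesgueI borel_measurable_continuous_onI continuous_intros)
qed (intro AE_I2, simp only: norm_exp_i_times)

text \<open>Prepared for the second slot of Parseval's identity: the conjugation there undoes the
  one in the statement and leaves the convolution factor \<open>g (\<xi> - \<eta>)\<close>. The case
  \<open>\<xi> = 0\<close> is the rule for conjugates.\<close>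

lemma is_fourier_L2_modulate_cnj:
  fixes f g :: "real^'n \<Rightarrow> complex"
  assumes "is_fourier_L2 f g"
  shows "is_fourier_L2 (\<lambda>x. exp (\<i> * of_real (x \<bullet> \<xi>)) * cnj (f x)) (\<lambda>\<eta>. cnj (g (\<xi> - \<eta>)))"
proof -
  obtain F where F: "f \<in> L2" "g \<in> L2" "\<And>k. F k \<in> L1" "\<And>k. F k \<in> L2" "\<And>k. fourier_L1 (F k) \<in> L2" 
    "L2_tendsto F f" "L2_tendsto (\<lambda>k. fourier_L1 (F k)) g" using assms unfolding is_fourier_L2_iff by auto
  let ?e = "\<lambda>x. exp (\<i> * complex_of_real (x \<bullet> \<xi>))"
  have e: "fourier_L1 (\<lambda>x. ?e x * cnj (F k x)) = (\<lambda>\<eta>. cnj (fourier_L1 (F k) (\<xi> - \<eta>)))" for k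
  proof
    fix \<eta>
    have "(LINT x|lebesgue. (?e x * cnj (F k x)) * exp (- \<i> * of_real (x \<bullet> \<eta>))) = 
       (LINT x|lebesgue. cnj (F k x * exp (- \<i> * of_real (x \<bullet> (\<xi> - \<eta>)))))"
    proof (rule Bochner_Integration.integral_cong)
      fix x
      have "cnj (exp (- \<i> * of_real (x \<bullet> (\<xi> - \<eta>)))) = ?e x * exp (- \<i> * of_real (x \<bullet> \<eta>))"
      proof -
        have "cnj (exp (- \<i> * of_real (x \<bullet> (\<xi> - \<eta>)))) = exp (\<i> * of_real (x \<bullet> \<xi>) + - \<i> * of_real (x \<bullet> \<eta>))"
          by (simp add: exp_cnj inner_diff_right algebra_simps)
        then show ?thesis by (simp only: exp_add)
      qed
      then show "(?e x * cnj (F k x)) * exp (- \<i> * of_real (x \<bullet> \<eta>)) = cnj (F k x * exp (- \<i> * of_real (x \<bullet> (\<xi> - \<eta>))))"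
        by simp
    qed simp
    also have "\<dots> = cnj (LINT x|lebesgue. F k x * exp (- \<i> * of_real (x \<bullet> (\<xi> - \<eta>))))"
      by (rule Bochner_Integration.integral_cnj)
    finally show "fourier_L1 (\<lambda>x. ?e x * cnj (F k x)) \<eta> = cnj (fourier_L1 (F k) (\<xi> - \<eta>))"
      by (simp add: fourier_L1_def)
  qed
  have c: "L2_tendsto (\<lambda>k x. cnj (H k x)) (\<lambda>x. cnj (h x))" if "L2_tendsto H h" for H and h :: "real^'n \<Rightarrow> complex"
    using that unfolding L2_tendsto_def by (simp flip: complex_cnj_diff)
  have d: "L2_tendsto (\<lambda>k x. ?e x * cnj (H k x)) (\<lambda>x. ?e x * cnj (h x))" if "L2_tendsto H h" for H h
    using that unfolding L2_tendsto_def by (simp add: norm_mult flip: right_diff_distrib complex_cnj_diff)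
  have l: "(\<lambda>x. ?e x * cnj (h x)) \<in> L1" if "h \<in> L1" for h
  proof -
    have "integrable lebesgue (\<lambda>x. h x * exp (- \<i> * of_real (x \<bullet> \<xi>)))"
      by (intro integrable_fourier_kernel) (use that in \<open>auto simp: L1_def\<close>)
    then have "integrable lebesgue (\<lambda>x. cnj (h x * exp (- \<i> * of_real (x \<bullet> \<xi>))))" by (simp only: Bochner_Integration.integrable_cnj)
    then show ?thesis by (simp add: L1_def exp_cnj mult.commute)
  qed
  show ?thesis
    unfolding is_fourier_L2_iff
  proof (intro conjI exI[of _ "\<lambda>k x. ?e x * cnj (F k x)"] allI; (unfold e)?)
    show "(\<lambda>x. ?e x * cnj (f x)) \<in> L2" by (rule L2_modulate_cnj[OF F(1)])
    show "(\<lambda>\<eta>. cnj (g (\<xi> - \<eta>))) \<in> L2" by (rule L2_cnj[OF L2_reflect[OF F(2)]])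
    show "(\<lambda>x. ?e x * cnj (F k x)) \<in> L1" for k by (rule l[OF F(3)])
    show "(\<lambda>x. ?e x * cnj (F k x)) \<in> L2" for k by (rule L2_modulate_cnj[OF F(4)])
    show "(\<lambda>\<eta>. cnj (fourier_L1 (F k) (\<xi> - \<eta>))) \<in> L2" for k by (rule L2_cnj[OF L2_reflect[OF F(5)]])
    show "L2_tendsto (\<lambda>k x. ?e x * cnj (F k x)) (\<lambda>x. ?e x * cnj (f x))" by (rule d[OF F(6)])
    show "L2_tendsto (\<lambda>k \<eta>. cnj (fourier_L1 (F k) (\<xi> - \<eta>))) (\<lambda>\<eta>. cnj (g (\<xi> - \<eta>)))"
      by (rule c[OF L2_tendsto_reflect[OF F(5,2,7)]])
  qed
qed

lemma is_fourier_L2_mult: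
  assumes "is_fourier_L2 f f'" "is_fourier_L2 g g'"
  shows "(LINT x|lebesgue. f' x * g x) = (LINT x|lebesgue. f x * g' x)"
proof -
  obtain F where F: "f \<in> L2" "f' \<in> L2" "\<And>k. F k \<in> L1" "\<And>k. F k \<in> L2" "\<And>k. fourier_L1 (F k) \<in> L2" 
    "L2_tendsto F f" "L2_tendsto (\<lambda>k. fourier_L1 (F k)) f'" using assms(1) unfolding is_fourier_L2_iff by auto
  obtain G where G: "g \<in> L2" "g' \<in> L2" "\<And>k. G k \<in> L1" "\<And>k. G k \<in> L2" "\<And>k. fourier_L1 (G k) \<in> L2" 
    "L2_tendsto G g" "L2_tendsto (\<lambda>k. fourier_L1 (G k)) g'" using assms(2) unfolding is_fourier_L2_iff by auto
  have "(\<lambda>k. LINT x|lebesgue. fourier_L1 (F k) x * G k x) \<longlonglongrightarrow> (LINT x|lebesgue. f' x * g x)"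
    by (intro L2_tendsto_inner F G)
  then have "(\<lambda>k. LINT x|lebesgue. F k x * fourier_L1 (G k) x) \<longlonglongrightarrow> (LINT x|lebesgue. f' x * g x)"
    by (simp only: fourier_L1_mult[OF F(3) G(3)])
  moreover have "(\<lambda>k. LINT x|lebesgue. F k x * fourier_L1 (G k) x) \<longlonglongrightarrow> (LINT x|lebesgue. f x * g' x)"
    by (intro L2_tendsto_inner F G)
  ultimately show ?thesis by (rule LIMSEQ_unique)
qed

text \<open>Let \<open>k\<close> be the transform of \<open>g\<close>. By the symmetry of the Fourier transform and Parseval's
  identity \<open>k - f \<circ> uminus\<close> is orthogonal to every square integrable function.\<close>

lemma is_fourier_L2_inversion:
  assumes fg: "is_fourier_L2 f g"
  shows "is_fourier_L2 g (\<lambda>x. f (- x))"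
proof -
  note L = is_fourier_L2_in_L2[OF fg]
  obtain k where gk: "is_fourier_L2 g k" using is_fourier_L2_exists[OF L(2)] by blast
  note kL = is_fourier_L2_in_L2(2)[OF gk]
  have fr: "(\<lambda>x. f (- x)) \<in> L2" using L2_reflect[OF L(1), of 0] by simp
  have key: "(LINT x|lebesgue. k x * u x) = (LINT x|lebesgue. f (- x) * u x)" if u: "u \<in> L2" for u
  proof -
    obtain u' where uu': "is_fourier_L2 u u'" using is_fourier_L2_exists[OF u] by blast
    \<comment> \<open>Conjugation followed by reflection gives a function whose transform is exactly
      \<open>cnj u'\<close>, so Parseval's identity can be read without conjugates.\<close>
    have "is_fourier_L2 (\<lambda>x. cnj (u x)) (\<lambda>x. cnj (u' (- x)))"
      using is_fourier_L2_modulate_cnj[OF uu', of 0] by simp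
    from is_fourier_L2_reflect[OF this]
    have c: "is_fourier_L2 (\<lambda>x. cnj (u (- x))) (\<lambda>x. cnj (u' x))" by simp
    have m: "(\<lambda>x. f x * u (- x)) \<in> borel_measurable lebesgue"
      using L2_measurable[OF L(1)] L2_measurable[OF L2_reflect[OF u, of 0]] by simp
    have "(LINT x|lebesgue. k x * u x) = (LINT x|lebesgue. g x * u' x)"
      by (rule is_fourier_L2_mult[OF gk uu'])
    also have "\<dots> = (LINT x|lebesgue. f x * u (- x))"
      using is_fourier_L2_parseval[OF fg c] by simp
    also have "\<dots> = (LINT x|lebesgue. f (- x) * u x)"
      using integral_reflect[OF m, where t=0] by simp
    finally show ?thesis .
  qed
  let ?d = "\<lambda>x. k x - f (- x)"
  have d: "?d \<in> L2" by (rule L2_diff[OF kL fr])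
  have "(LINT x|lebesgue. ?d x * cnj (?d x)) = (LINT x|lebesgue. k x * cnj (?d x)) - (LINT x|lebesgue. f (- x) * cnj (?d x))"
    using L2_mult_integrable[OF kL L2_cnj[OF d]] L2_mult_integrable[OF fr L2_cnj[OF d]] 
    by (simp only: left_diff_distrib Bochner_Integration.integral_diff)
  also have "\<dots> = 0" using key[OF L2_cnj[OF d]] by simp
  finally have "complex_of_real (LINT x|lebesgue. (norm (?d x))\<^sup>2) = 0"
    unfolding complex_norm_square[symmetric] by (simp only: integral_complex_of_real)
  then have "AE x in lebesgue. ?d x = 0" using L2_norm_zero_AE[OF d] by simp
  then have "AE x in lebesgue. k x = f (- x)" by simp
  then show ?thesis
    using is_fourier_L2_cong_AE[OF gk L2_measurable[OF L(2)] _ L2_measurable[OF fr]] by simp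
qed

text \<open>By inversion the reflected transform of \<open>g\<close> is a preimage of
  \<open>g\<close>.\<close>

lemma is_fourier_L2_surj:
  assumes "g \<in> L2"
  shows "\<exists>f. is_fourier_L2 f g"
proof -
  obtain k where "is_fourier_L2 g k" using is_fourier_L2_exists[OF assms] by blast
  from is_fourier_L2_reflect[OF is_fourier_L2_inversion[OF this]] show ?thesis by auto
qed

lemma fourier_L2_is_fourier: "f \<in> L2 \<Longrightarrow> is_fourier_L2 f (fourier_L2 f)"
  unfolding fourier_L2_def by (rule someI_ex[OF is_fourier_L2_exists])

lemma fourier_L2_unique:
  assumes "is_fourier_L2 f g"
  shows "AE x in lebesgue. fourier_L2 f x = g x"
  using is_fourier_L2_AE_eq_iff[OF fourier_L2_is_fourier[OF is_fourier_L2_in_L2(1)[OF assms]] assms] by simp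

text \<open>The convolution theorem is Parseval's identity for \<open>f\<close> and the modulated
  conjugate of \<open>g\<close>. It holds at every \<open>\<xi>\<close>, since the left side is an
  honest Fourier integral.\<close>

lemma fourier_L1_product:
  fixes f g :: "real^'n \<Rightarrow> complex"
  assumes "is_fourier_L2 f f'" "is_fourier_L2 g g'"
  shows "fourier_L1 (\<lambda>x. f x * g x) \<xi> = of_real (fourier_const TYPE('n)) * (LINT \<eta>|lebesgue. f' \<eta> * g' (\<xi> - \<eta>))"
proof -
  have "(LINT x|lebesgue. f x * g x * exp (- \<i> * of_real (x \<bullet> \<xi>))) = (LINT x|lebesgue. f x * cnj (exp (\<i> * of_real (x \<bullet> \<xi>)) * cnj (g x)))"
    by (simp add: exp_cnj mult_ac)
  also have "\<dots> = (LINT \<eta>|lebesgue. f' \<eta> * cnj (cnj (g' (\<xi> - \<eta>))))"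
    by (rule is_fourier_L2_parseval[symmetric, OF assms(1) is_fourier_L2_modulate_cnj[OF assms(2)]])
  finally show ?thesis by (simp add: fourier_L1_def)
qed

section \<open>The Bedrosian identity\<close>

lemma borel_measurable_sgn_nth:
  "(\<lambda>x::real^'n. complex_of_real (sgn (x $ j))) \<in> borel_measurable borel"
  by measurable

lemma norm_sgn_le: "norm (complex_of_real (sgn t)) \<le> 1"
  by (simp add: sgn_if)

text \<open>Surjectivity of the transform provides a witness for the choice in
  \<open>partial_hilbert\<close>, so the chosen function does have the prescribed transform up to a
  null set.\<close>

lemma is_fourier_L2_partial_hilbert:
  fixes f :: "real^'n \<Rightarrow> complex"
  assumes P: "is_fourier_L2 f f'"
  shows "is_fourier_L2 (partial_hilbert j f) (\<lambda>\<xi>. - \<i> * of_real (sgn (\<xi> $ j)) * f' \<xi>)"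
proof -
  have s: "(\<lambda>\<xi>::real^'n. - \<i> * complex_of_real (sgn (\<xi> $ j))) \<in> borel_measurable lebesgue"
    by (intro borel_measurable_lebesgueI borel_measurable_times borel_measurable_sgn_nth) simp
  have m: "(\<lambda>\<xi>. - \<i> * of_real (sgn (\<xi> $ j)) * u \<xi>) \<in> L2" if "u \<in> L2" for u :: "real^'n \<Rightarrow> complex"
  proof (rule L2_bounded_mult[OF that s, of 1])
    show "AE x in lebesgue. norm (- \<i> * complex_of_real (sgn ((x::real^'n) $ j))) \<le> 1"
      using norm_sgn_le by (intro AE_I2) (simp add: norm_mult)
  qed
  note fL = is_fourier_L2_in_L2[OF P]
  have F: "is_fourier_L2 f (fourier_L2 f)" by (rule fourier_L2_is_fourier[OF fL(1)])
  obtain h where "is_fourier_L2 h (\<lambda>\<xi>. - \<i> * of_real (sgn (\<xi> $ j)) * fourier_L2 f \<xi>)"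
    using is_fourier_L2_surj[OF m[OF is_fourier_L2_in_L2(2)[OF F]]] by blast
  then have "h \<in> L2 \<and> (AE \<xi> in lebesgue. fourier_L2 h \<xi> = - \<i> * of_real (sgn (\<xi> $ j)) * fourier_L2 f \<xi>)"
    using fourier_L2_unique is_fourier_L2_in_L2(1) by blast
  then have "partial_hilbert j f \<in> L2 \<and> 
     (AE \<xi> in lebesgue. fourier_L2 (partial_hilbert j f) \<xi> = - \<i> * of_real (sgn (\<xi> $ j)) * fourier_L2 f \<xi>)"
    unfolding partial_hilbert_def
    by (rule someI[where P="\<lambda>h. h \<in> L2 \<and> (AE \<xi> in lebesgue. fourier_L2 h \<xi> = - \<i> * of_real (sgn (\<xi> $ j)) * fourier_L2 f \<xi>)"])
  then have H: "partial_hilbert j f \<in> L2" 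
     "AE \<xi> in lebesgue. fourier_L2 (partial_hilbert j f) \<xi> = - \<i> * of_real (sgn (\<xi> $ j)) * fourier_L2 f \<xi>" by auto
  have ae: "AE \<xi> in lebesgue. fourier_L2 (partial_hilbert j f) \<xi> = - \<i> * of_real (sgn (\<xi> $ j)) * f' \<xi>"
    using H(2) fourier_L2_unique[OF P] by eventually_elim simp
  show ?thesis
    by (rule is_fourier_L2_cong_AE[OF fourier_L2_is_fourier[OF H(1)] L2_measurable[OF H(1)] _ L2_measurable[OF m[OF fL(2)]] ae]) simp
qed

text \<open>Boundedness of \<open>f\<close> keeps \<open>f g\<close> and the product of
  \<open>f\<close> with the Hilbert transform of \<open>g\<close> in L2. Both transforms are then
  given by the convolution theorem, injectivity allows comparing them, and the nonzero factor
  \<open>- \<i>\<close> times the normalising constant cancels.\<close>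

lemma bedrosian_fourier_iff:
  fixes f g :: "real^'n \<Rightarrow> complex"
  assumes f: "is_fourier_L2 f f'" "f \<in> Linf" and g: "is_fourier_L2 g g'"
  shows "(AE x in lebesgue. partial_hilbert j (\<lambda>y. f y * g y) x = f x * partial_hilbert j g x) \<longleftrightarrow>
    (AE \<xi> in lebesgue. of_real (sgn (\<xi> $ j)) * (LINT \<eta>|lebesgue. f' \<eta> * g' (\<xi> - \<eta>)) = 
       (LINT \<eta>|lebesgue. f' \<eta> * (of_real (sgn ((\<xi> - \<eta>) $ j)) * g' (\<xi> - \<eta>))))"
proof -
  note fL = is_fourier_L2_in_L2[OF f(1)]
  obtain C where C: "f \<in> borel_measurable lebesgue" "AE x in lebesgue. norm (f x) \<le> C"
    using f(2) by (auto simp: Linf_def)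
  have prod: "is_fourier_L2 (\<lambda>x. f x * u x) (\<lambda>\<xi>. of_real (fourier_const TYPE('n)) * (LINT \<eta>|lebesgue. f' \<eta> * u' (\<xi> - \<eta>)))"
    if u: "is_fourier_L2 u u'" for u u'
  proof -
    note uL = is_fourier_L2_in_L2[OF u]
    have "(\<lambda>x. f x * u x) \<in> L1 \<inter> L2" using L2_mult_L1[OF fL(1) uL(1)] L2_bounded_mult[OF uL(1) C] by blast
    from is_fourier_L2_L1[OF this] show ?thesis unfolding fourier_L1_product[OF f(1) u, abs_def] .
  qed
  note H = is_fourier_L2_partial_hilbert[OF prod[OF g], of j]
  note K = prod[OF is_fourier_L2_partial_hilbert[OF g, of j]]
  have c0: "fourier_const TYPE('n) \<noteq> 0" by simp
  have eq: "(- \<i> * of_real (sgn (\<xi> $ j)) * (of_real (fourier_const TYPE('n)) * (LINT \<eta>|lebesgue. f' \<eta> * g' (\<xi> - \<eta>))) = 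
       of_real (fourier_const TYPE('n)) * (LINT \<eta>|lebesgue. f' \<eta> * (- \<i> * of_real (sgn ((\<xi> - \<eta>) $ j)) * g' (\<xi> - \<eta>)))) \<longleftrightarrow>
    (of_real (sgn (\<xi> $ j)) * (LINT \<eta>|lebesgue. f' \<eta> * g' (\<xi> - \<eta>)) = 
       (LINT \<eta>|lebesgue. f' \<eta> * (of_real (sgn ((\<xi> - \<eta>) $ j)) * g' (\<xi> - \<eta>))))" (is "?A = ?B") for \<xi>
  proof -
    let ?I = "LINT \<eta>|lebesgue. f' \<eta> * (of_real (sgn ((\<xi> - \<eta>) $ j)) * g' (\<xi> - \<eta>))"
    let ?J = "LINT \<eta>|lebesgue. f' \<eta> * g' (\<xi> - \<eta>)"
    have "(LINT \<eta>|lebesgue. f' \<eta> * (- \<i> * of_real (sgn ((\<xi> - \<eta>) $ j)) * g' (\<xi> - \<eta>))) = 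
       (LINT \<eta>|lebesgue. (- \<i>) * (f' \<eta> * (of_real (sgn ((\<xi> - \<eta>) $ j)) * g' (\<xi> - \<eta>))))"
      by (intro Bochner_Integration.integral_cong) (simp_all only: mult_ac)
    also have "\<dots> = - \<i> * ?I" by (rule integral_mult_right_zero)
    finally have "?A \<longleftrightarrow> (- \<i> * of_real (fourier_const TYPE('n))) * (of_real (sgn (\<xi> $ j)) * ?J) = (- \<i> * of_real (fourier_const TYPE('n))) * ?I"
      by (simp only: mult_ac)
    also have "\<dots> \<longleftrightarrow> ?B" using c0 by (subst mult_left_cancel) simp_all
    finally show ?thesis .
  qed
  show ?thesis using is_fourier_L2_AE_eq_iff[OF H K] unfolding eq by simp
qed

section \<open>Essential closures and supports\<close>

text \<open>Every exceptional point lies in a basic open set that meets \<open>E\<close> in a null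
  set, and the basis is countable.\<close>

lemma AE_in_ess_closure:
  fixes E :: "(real^'n) set"
  assumes E: "E \<in> sets lebesgue"
  shows "AE x in lebesgue. x \<in> E \<longrightarrow> x \<in> ess_closure E"
proof -
  obtain B :: "(real^'n) set set" where B: "countable B" "topological_basis B" using ex_countable_basis by blast
  define N where "N = (\<Union>V\<in>{V\<in>B. emeasure lebesgue (V \<inter> E) = 0}. V \<inter> E)"
  have "N \<in> null_sets lebesgue"
    unfolding N_def
  proof (rule null_sets_UN')
    show "countable {V\<in>B. emeasure lebesgue (V \<inter> E) = 0}" using B(1) by simp
    fix V assume V: "V \<in> {V\<in>B. emeasure lebesgue (V \<inter> E) = 0}"
    then have "open V" using B(2) topological_basis_open by blast
    then show "V \<inter> E \<in> null_sets lebesgue" using V E by (intro null_setsI) auto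
  qed
  then show ?thesis
  proof (rule AE_I'[rule_format])
    show "{x \<in> space lebesgue. \<not> (x \<in> E \<longrightarrow> x \<in> ess_closure E)} \<subseteq> N"
    proof
      fix x assume "x \<in> {x \<in> space lebesgue. \<not> (x \<in> E \<longrightarrow> x \<in> ess_closure E)}"
      then obtain U where U: "x \<in> E" "open U" "x \<in> U" "emeasure lebesgue (U \<inter> E) = 0"
        by (auto simp: ess_closure_def zero_less_iff_neq_zero)
      obtain V where V: "V \<in> B" "x \<in> V" "V \<subseteq> U" using topological_basisE[OF B(2) U(2,3)] .
      have "emeasure lebesgue (V \<inter> E) \<le> emeasure lebesgue (U \<inter> E)"
        using V U E by (intro emeasure_mono sets.Int) auto
      then show "x \<in> N" using U V by (auto simp: N_def)
    qed
  qed
qed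

lemma AE_supp_subset:
  assumes "\<phi> \<in> borel_measurable lebesgue" "A \<in> sets lebesgue" "supp \<phi> \<subseteq> A"
  shows "AE x in lebesgue. \<phi> x \<noteq> 0 \<longrightarrow> x \<in> ess_closure A"
proof -
  have "{x \<in> space lebesgue. \<phi> x \<noteq> 0} \<in> sets lebesgue"
    using assms(1) by measurable
  then have "{x. \<phi> x \<noteq> 0} \<in> sets lebesgue" by simp
  from AE_in_ess_closure[OF this] AE_in_ess_closure[OF assms(2)] show ?thesis
    by eventually_elim (use assms(3) in \<open>auto simp: supp_def\<close>)
qed

lemma supp_subset_closed:
  assumes "closed K" "AE x in lebesgue. x \<notin> K \<longrightarrow> \<phi> x = 0"
  shows "supp \<phi> \<subseteq> K"
proof (rule ccontr)
  assume "\<not> supp \<phi> \<subseteq> K"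
  then obtain x where "x \<in> supp \<phi>" "x \<in> - K" by blast
  then have "emeasure lebesgue (- K \<inter> {x. \<phi> x \<noteq> 0}) > 0"
    using assms(1) by (auto simp: supp_def ess_closure_def open_Compl)
  moreover have "AE x in lebesgue. x \<notin> - K \<inter> {x. \<phi> x \<noteq> 0}" using assms(2) by eventually_elim auto
  \<comment> \<open>A nonmeasurable set has \<open>emeasure\<close> 0 by default, so the conclusion
    holds whether or not this set is measurable.\<close>
  then have "emeasure lebesgue (- K \<inter> {x. \<phi> x \<noteq> 0}) = 0"
    using AE_iff_null_sets[of "- K \<inter> {x. \<phi> x \<noteq> 0}" lebesgue] emeasure_notin_sets[of "- K \<inter> {x. \<phi> x \<noteq> 0}" lebesgue] by blast
  ultimately show False by simp
qed

lemma AE_nth_nonzero: "AE x in lebesgue. (x::real^'n) $ j \<noteq> 0"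
proof -
  have "negligible {x::real^'n. axis j 1 \<bullet> x = 0}"
    by (rule negligible_hyperplane) (simp add: axis_eq_0_iff)
  then have "{x::real^'n. x $ j = 0} \<in> null_sets lebesgue"
    by (simp add: inner_axis inner_commute negligible_iff_null_sets)
  from AE_not_in[OF this] show ?thesis by simp
qed

section \<open>Test functions with compactly supported transforms\<close>

text \<open>Inner regularity. A closed set contains the support of its indicator, which keeps that
  support inside \<open>A\<close> even though \<open>A\<close> need not contain its own essential
  closure.\<close>

lemma ess_closure_compact_subset:
  fixes A :: "(real^'n) set"
  assumes A: "A \<in> sets lebesgue" and x: "x \<in> ess_closure A" and d: "d > 0"
  obtains K where "compact K" "K \<subseteq> A" "K \<subseteq> ball x d" "emeasure lebesgue K > 0"
proof -
  let ?S = "ball x d \<inter> A"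
  have S: "?S \<in> sets lebesgue" by (intro sets.Int A fmeasurableD lmeasurable_ball)
  have "emeasure lebesgue ?S > 0" using x d by (auto simp: ess_closure_def)
  then obtain b where b: "0 < b" "b < emeasure lebesgue ?S" using dense by blast
  then obtain e :: real where e: "0 < e" "ennreal e < emeasure lebesgue ?S" by (cases b) auto
  obtain T where T: "closed T" "T \<subseteq> ?S" "emeasure lebesgue (?S - T) < ennreal e"
    using sets_lebesgue_inner_closed[OF S e(1)] .
  show ?thesis
  proof
    show "compact T" using T bounded_subset[OF bounded_ball] by (auto simp: compact_eq_bounded_closed)
    have "emeasure lebesgue ?S \<le> emeasure lebesgue T + emeasure lebesgue (?S - T)"
      using T S by (intro order_trans[OF _ emeasure_subadditive] emeasure_mono) auto
    then have "emeasure lebesgue T \<noteq> 0" using T(3) e(2) by auto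
    then show "emeasure lebesgue T > 0" by (simp add: zero_less_iff_neq_zero)
  qed (use T in auto)
qed

text \<open>By inversion \<open>f\<close> is almost everywhere a reflected Fourier integral of the
  integrable function \<open>k\<close>. This supplies the boundedness demanded of the test
  functions.\<close>

lemma inverse_fourier_bounded:
  assumes P: "is_fourier_L2 f k" and k: "k \<in> L1 \<inter> L2"
  shows "f \<in> Linf"
proof -
  have "AE x in lebesgue. f (- x) = fourier_L1 k x"
    using is_fourier_L2_AE_eq_iff[OF is_fourier_L2_inversion[OF P] is_fourier_L2_L1[OF k]] by simp
  from AE_reflect[OF this, of 0] have "AE x in lebesgue. f x = fourier_L1 k (- x)" by simp
  then have "AE x in lebesgue. norm (f x) \<le> fourier_const TYPE('a) * (LINT x|lebesgue. norm (k x))"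
    by eventually_elim (simp only: norm_fourier_L1_le)
  then show ?thesis using L2_measurable[OF is_fourier_L2_in_L2(1)[OF P]] by (auto simp: Linf_def)
qed

lemma indicator_compact_L1_L2:
  fixes K :: "(real^'n) set"
  assumes K: "compact K"
  shows "(indicator K :: real^'n \<Rightarrow> complex) \<in> L1 \<inter> L2"
proof -
  have s: "K \<in> sets lebesgue" by (rule sets_completionI_sets) (simp add: borel_compact K)
  have f: "emeasure lebesgue K < \<infinity>" 
    using emeasure_bounded_finite[OF compact_imp_bounded[OF K]] borel_compact[OF K] by simp
  have m: "(indicator K :: real^'n \<Rightarrow> complex) \<in> borel_measurable lebesgue"
    using s by (rule borel_measurable_indicator)
  have i: "integrable lebesgue (indicator K :: real^'n \<Rightarrow> real)"
    using s f by (simp add: integrable_indicator_iff)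
  have "(\<lambda>x. (norm (indicator K x :: complex))\<^sup>2) = indicator K"
    by (auto simp: fun_eq_iff indicator_def)
  then have "(indicator K :: real^'n \<Rightarrow> complex) \<in> L2"
    using i by (intro L2I m) simp
  moreover have "integrable lebesgue (indicator K :: real^'n \<Rightarrow> complex)"
    by (rule Bochner_Integration.integrable_bound[OF i m]) (auto simp: indicator_def)
  ultimately show ?thesis by (simp add: L1_def)
qed

text \<open>By Tonelli's theorem the integral of the convolution is the product of the measures of
  \<open>K\<close> and \<open>L\<close>.\<close>

lemma AE_convolution_indicator_zero:
  fixes K L :: "(real^'n) set"
  assumes K: "compact K" and L: "compact L"
    and zero: "AE \<xi> in lebesgue. (LINT \<eta>|lebesgue. (indicator K \<eta> :: complex) * indicator L (\<xi> - \<eta>)) = 0"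
  shows "emeasure lebesgue K = 0 \<or> emeasure lebesgue L = 0"
proof -
  have [measurable]: "K \<in> sets borel" "L \<in> sets borel" using K L borel_compact by auto
  have "AE \<xi> in lebesgue. (\<integral>\<^sup>+\<eta>. indicator K \<eta> * indicator L (\<xi> - \<eta>) \<partial>lborel) = 0"
    using zero
  proof eventually_elim
    fix \<xi> assume z: "(LINT \<eta>|lebesgue. (indicator K \<eta> :: complex) * indicator L (\<xi> - \<eta>)) = 0"
    let ?M = "{\<eta>. \<eta> \<in> K \<and> \<xi> - \<eta> \<in> L}"
    have [measurable]: "?M \<in> sets borel" by measurable
    have "?M \<subseteq> K" by auto
    then have "bounded ?M" using bounded_subset compact_imp_bounded[OF K] by blast
    \<comment> \<open>Finiteness rules out that \<open>measure\<close> is 0 merely by its default on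
      sets of infinite measure.\<close>
    then have fin: "emeasure lborel ?M < \<infinity>" by (rule emeasure_bounded_finite)
    have "(LINT \<eta>|lebesgue. (indicator K \<eta> :: complex) * indicator L (\<xi> - \<eta>)) = (LINT \<eta>|lebesgue. complex_of_real (indicator ?M \<eta>))"
      by (intro Bochner_Integration.integral_cong) (auto simp: indicator_def)
    also have "\<dots> = complex_of_real (LINT \<eta>|lebesgue. indicator ?M \<eta>)" by (rule integral_complex_of_real)
    also have "\<dots> = complex_of_real (measure lborel ?M)" by (subst integral_completion) simp_all
    finally have "measure lborel ?M = 0" using z by simp
    then have "emeasure lborel ?M = 0" using fin by (auto simp: measure_def enn2real_eq_0_iff)
    moreover have "(\<integral>\<^sup>+\<eta>. indicator K \<eta> * indicator L (\<xi> - \<eta>) \<partial>lborel) = (\<integral>\<^sup>+\<eta>. indicator ?M \<eta> \<partial>lborel)"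
      by (intro nn_integral_cong) (auto simp: indicator_def)
    ultimately show "(\<integral>\<^sup>+\<eta>. indicator K \<eta> * indicator L (\<xi> - \<eta>) \<partial>lborel) = 0" by simp
  qed
  then have "(\<integral>\<^sup>+\<xi>. (\<integral>\<^sup>+\<eta>. indicator K \<eta> * indicator L (\<xi> - \<eta>) \<partial>lborel) \<partial>lebesgue) = (\<integral>\<^sup>+\<xi>. 0 \<partial>(lebesgue :: (real^'n) measure))"
    by (rule nn_integral_cong_AE)
  then have "0 = (\<integral>\<^sup>+\<xi>. (\<integral>\<^sup>+\<eta>. indicator K \<eta> * indicator L (\<xi> - \<eta>) \<partial>lborel) \<partial>lborel)"
    by (simp add: nn_integral_completion)
  also have "\<dots> = (\<integral>\<^sup>+\<eta>. (\<integral>\<^sup>+\<xi>. indicator K \<eta> * indicator L (\<xi> - \<eta>) \<partial>lborel) \<partial>lborel)"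
    by (rule lborel_pair.Fubini') measurable
  also have "\<dots> = (\<integral>\<^sup>+\<eta>. indicator K \<eta> * emeasure lborel L \<partial>lborel)"
  proof (rule nn_integral_cong)
    fix \<eta>
    have "(\<integral>\<^sup>+\<xi>. indicator L (\<xi> - \<eta>) \<partial>lborel) = (\<integral>\<^sup>+\<xi>. indicator L \<xi> \<partial>distr lborel borel (\<lambda>x. x - \<eta>))"
      by (subst nn_integral_distr) auto
    then show "(\<integral>\<^sup>+\<xi>. indicator K \<eta> * indicator L (\<xi> - \<eta>) \<partial>lborel) = indicator K \<eta> * emeasure lborel L"
      by (subst nn_integral_cmult) (simp_all add: distr_lborel_translate)
  qed
  also have "\<dots> = emeasure lborel K * emeasure lborel L" by (simp add: nn_integral_multc)
  finally show ?thesis by simp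
qed

section \<open>Equivalence with a condition on signs\<close>

text \<open>Only strictly opposite signs are excluded: \<open>p $ j + q $ j = 0\<close> remains
  possible. The contradiction comes from a convolution of two indicators on whose support the
  identity equates a number with its negative.\<close>

lemma bedrosian_signs:
  fixes A B :: "(real^'n) set"
  assumes A: "A \<in> sets lebesgue" and B: "B \<in> sets lebesgue"
    and bed: "bedrosian_identity (partial_hilbert j) A B"
    and p: "p \<in> ess_closure A" and q: "q \<in> ess_closure B" and q0: "q $ j \<noteq> 0"
  shows "sgn (p $ j + q $ j) \<noteq> - sgn (q $ j)"
proof
  assume sg: "sgn (p $ j + q $ j) = - sgn (q $ j)"
  \<comment> \<open>Points of \<open>ball q d\<close> keep the sign of \<open>q $ j\<close>. A sum
    of a point near \<open>p\<close> and one near \<open>q\<close> moves by less than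
    \<open>2 * d\<close> in component \<open>j\<close>, hence the factor 1/2 in the second
    bound.\<close>
  define d where "d = min \<bar>q $ j\<bar> (\<bar>p $ j + q $ j\<bar> / 2)"
  have pq0: "p $ j + q $ j \<noteq> 0" using sg q0 by (auto simp: sgn_if split: if_splits)
  have d: "d > 0" using q0 pq0 by (simp add: d_def)
  obtain K where K: "compact K" "K \<subseteq> A" "K \<subseteq> ball p d" "emeasure lebesgue K > 0"
    using ess_closure_compact_subset[OF A p d] .
  obtain L where L: "compact L" "L \<subseteq> B" "L \<subseteq> ball q d" "emeasure lebesgue L > 0"
    using ess_closure_compact_subset[OF B q d] .
  have nth: "\<bar>x $ j - y $ j\<bar> < d" if "x \<in> ball y d" for x y :: "real^'n"
    using that component_le_norm_cart[of "x - y" j] by (simp add: dist_norm norm_minus_commute)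
  have dle: "d \<le> \<bar>q $ j\<bar>" "2 * d \<le> \<bar>p $ j + q $ j\<bar>" unfolding d_def by (auto simp: min_def)
  have close: "sgn s = sgn t" if "\<bar>s - t\<bar> < \<bar>t\<bar>" for s t :: real
    using that by (auto simp: sgn_if abs_if split: if_splits)
  have Lsgn: "sgn (y $ j) = sgn (q $ j)" if "y \<in> L" for y
    using nth[of y q] that L(3) dle by (intro close) auto
  have KLsgn: "sgn (z $ j) = - sgn (q $ j)" if "y \<in> K" "z - y \<in> L" for y z
  proof -
    have "\<bar>y $ j - p $ j\<bar> < d" "\<bar>(z - y) $ j - q $ j\<bar> < d" using nth that K(3) L(3) by blast+
    then have "\<bar>z $ j - (p $ j + q $ j)\<bar> < \<bar>p $ j + q $ j\<bar>" using dle(2) unfolding vector_minus_component by linarith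
    from close[OF this] show ?thesis using sg by simp
  qed
  \<comment> \<open>The test functions are inverse transforms of indicators of compact sets.\<close>
  have ext: "\<exists>f. is_fourier_L2 f (indicator S) \<and> f \<in> L2 \<inter> Linf \<and> supp (fourier_L2 f) \<subseteq> S" if S: "compact S" for S :: "(real^'n) set"
  proof -
    note SL = indicator_compact_L1_L2[OF S]
    obtain f where f: "is_fourier_L2 f (indicator S)" using is_fourier_L2_surj SL by blast
    have "AE x in lebesgue. x \<notin> S \<longrightarrow> fourier_L2 f x = 0"
      using fourier_L2_unique[OF f] by eventually_elim simp
    then have "supp (fourier_L2 f) \<subseteq> S" by (intro supp_subset_closed compact_imp_closed S)
    then show ?thesis using f inverse_fourier_bounded[OF f SL] is_fourier_L2_in_L2(1)[OF f] by blast
  qed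
  obtain f where f: "is_fourier_L2 f (indicator K)" "f \<in> L2 \<inter> Linf" "supp (fourier_L2 f) \<subseteq> K" using ext[OF K(1)] by blast
  obtain g where g: "is_fourier_L2 g (indicator L)" "g \<in> L2 \<inter> Linf" "supp (fourier_L2 g) \<subseteq> L" using ext[OF L(1)] by blast
  have "AE x in lebesgue. partial_hilbert j (\<lambda>y. f y * g y) x = f x * partial_hilbert j g x"
    using bed f g K(2) L(2) unfolding bedrosian_identity_def by blast
  then have "AE \<xi> in lebesgue. of_real (sgn (\<xi> $ j)) * (LINT \<eta>|lebesgue. indicator K \<eta> * indicator L (\<xi> - \<eta>)) = 
       (LINT \<eta>|lebesgue. (indicator K \<eta> :: complex) * (of_real (sgn ((\<xi> - \<eta>) $ j)) * indicator L (\<xi> - \<eta>)))"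
    using bedrosian_fourier_iff[OF f(1) _ g(1)] f(2) by blast
  then have "AE \<xi> in lebesgue. (LINT \<eta>|lebesgue. (indicator K \<eta> :: complex) * indicator L (\<xi> - \<eta>)) = 0"
  proof eventually_elim
    fix \<xi> :: "real^'n"
    let ?I = "LINT \<eta>|lebesgue. (indicator K \<eta> :: complex) * indicator L (\<xi> - \<eta>)"
    assume e: "of_real (sgn (\<xi> $ j)) * ?I = 
       (LINT \<eta>|lebesgue. (indicator K \<eta> :: complex) * (of_real (sgn ((\<xi> - \<eta>) $ j)) * indicator L (\<xi> - \<eta>)))"
    have "(LINT \<eta>|lebesgue. (indicator K \<eta> :: complex) * (of_real (sgn ((\<xi> - \<eta>) $ j)) * indicator L (\<xi> - \<eta>))) = 
       (LINT \<eta>|lebesgue. of_real (sgn (q $ j)) * ((indicator K \<eta> :: complex) * indicator L (\<xi> - \<eta>)))"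
      using Lsgn by (intro Bochner_Integration.integral_cong) (auto simp: indicator_def simp del: vector_minus_component)
    also have "\<dots> = of_real (sgn (q $ j)) * ?I" by (rule integral_mult_right_zero)
    finally have e2: "of_real (sgn (\<xi> $ j)) * ?I = of_real (sgn (q $ j)) * ?I" using e by simp
    show "?I = 0"
    \<comment> \<open>If \<open>\<xi>\<close> is a sum of points of \<open>K\<close> and
      \<open>L\<close>, its sign is opposite to that of \<open>q $ j\<close>, so \<open>?I\<close>
      equals \<open>- ?I\<close>; otherwise the integrand vanishes identically.\<close>
    proof (cases "\<exists>\<eta>. \<eta> \<in> K \<and> \<xi> - \<eta> \<in> L")
      case True
      then have "sgn (\<xi> $ j) = - sgn (q $ j)" using KLsgn by blast
      with e2 q0 show ?thesis by (auto simp: sgn_if split: if_splits)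
    next
      case False
      then have "(\<lambda>\<eta>. (indicator K \<eta> :: complex) * indicator L (\<xi> - \<eta>)) = (\<lambda>_. 0)"
        by (auto simp: fun_eq_iff indicator_def)
      then show ?thesis by simp
    qed
  qed
  from AE_convolution_indicator_zero[OF K(1) L(1) this] K(4) L(4) show False by auto
qed

text \<open>With \<open>p = \<eta>\<close> and \<open>q = \<xi> - \<eta>\<close>, the exempted cases
  are \<open>\<xi> $ j = 0\<close>, a null set for the outer variable, and
  \<open>(\<xi> - \<eta>) $ j = 0\<close>, a null set for the inner one.\<close>

lemma bedrosian_identityI:
  fixes A B :: "(real^'n) set"
  assumes A: "A \<in> sets lebesgue" and B: "B \<in> sets lebesgue"
    and signs: "\<And>p q. p \<in> ess_closure A \<Longrightarrow> q \<in> ess_closure B \<Longrightarrow> q $ j \<noteq> 0 \<Longrightarrow> p $ j + q $ j \<noteq> 0 \<Longrightarrow> 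
      sgn (p $ j + q $ j) = sgn (q $ j)"
  shows "bedrosian_identity (partial_hilbert j) A B"
  unfolding bedrosian_identity_def
proof (intro ballI impI)
  fix f g :: "real^'n \<Rightarrow> complex"
  assume f: "f \<in> L2 \<inter> Linf" and g: "g \<in> L2 \<inter> Linf" and fA: "supp (fourier_L2 f) \<subseteq> A" and gB: "supp (fourier_L2 g) \<subseteq> B"
  let ?f = "fourier_L2 f" let ?g = "fourier_L2 g"
  have Ff: "is_fourier_L2 f ?f" and Fg: "is_fourier_L2 g ?g" using f g fourier_L2_is_fourier by blast+
  have m: "?f \<in> borel_measurable lebesgue" "?g \<in> borel_measurable lebesgue"
    using is_fourier_L2_in_L2(2)[OF Ff] is_fourier_L2_in_L2(2)[OF Fg] by (auto intro: L2_measurable)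
  have "AE \<xi> in lebesgue. of_real (sgn (\<xi> $ j)) * (LINT \<eta>|lebesgue. ?f \<eta> * ?g (\<xi> - \<eta>)) = 
       (LINT \<eta>|lebesgue. ?f \<eta> * (of_real (sgn ((\<xi> - \<eta>) $ j)) * ?g (\<xi> - \<eta>)))"
    using AE_nth_nonzero[of j]
  proof eventually_elim
    fix \<xi> :: "real^'n" assume \<xi>: "\<xi> $ j \<noteq> 0"
    have "of_real (sgn (\<xi> $ j)) * (LINT \<eta>|lebesgue. ?f \<eta> * ?g (\<xi> - \<eta>)) = 
       (LINT \<eta>|lebesgue. of_real (sgn (\<xi> $ j)) * (?f \<eta> * ?g (\<xi> - \<eta>)))"
      by (rule integral_mult_right_zero[symmetric])
    also have "\<dots> = (LINT \<eta>|lebesgue. ?f \<eta> * (of_real (sgn ((\<xi> - \<eta>) $ j)) * ?g (\<xi> - \<eta>)))"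
    proof (rule integral_cong_AE)
      have "(\<lambda>\<eta>::real^'n. complex_of_real (sgn ((\<xi> - \<eta>) $ j))) \<in> borel_measurable lebesgue"
        by (rule borel_measurable_reflect[OF borel_measurable_lebesgueI[OF borel_measurable_sgn_nth]])
      then show "(\<lambda>\<eta>. ?f \<eta> * (of_real (sgn ((\<xi> - \<eta>) $ j)) * ?g (\<xi> - \<eta>))) \<in> borel_measurable lebesgue"
        by (intro borel_measurable_times m(1) borel_measurable_reflect[OF m(2)])
      show "(\<lambda>\<eta>. of_real (sgn (\<xi> $ j)) * (?f \<eta> * ?g (\<xi> - \<eta>))) \<in> borel_measurable lebesgue"
        by (intro borel_measurable_times m(1) borel_measurable_reflect[OF m(2)] borel_measurable_const)
      show "AE \<eta> in lebesgue. of_real (sgn (\<xi> $ j)) * (?f \<eta> * ?g (\<xi> - \<eta>)) = ?f \<eta> * (of_real (sgn ((\<xi> - \<eta>) $ j)) * ?g (\<xi> - \<eta>))"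
        using AE_supp_subset[OF m(1) A fA] AE_reflect[OF AE_supp_subset[OF m(2) B gB], of \<xi>] AE_reflect[OF AE_nth_nonzero[of j], of \<xi>]
      proof eventually_elim
        fix \<eta> assume a: "?f \<eta> \<noteq> 0 \<longrightarrow> \<eta> \<in> ess_closure A" "?g (\<xi> - \<eta>) \<noteq> 0 \<longrightarrow> \<xi> - \<eta> \<in> ess_closure B" "(\<xi> - \<eta>) $ j \<noteq> 0"
        show "of_real (sgn (\<xi> $ j)) * (?f \<eta> * ?g (\<xi> - \<eta>)) = ?f \<eta> * (of_real (sgn ((\<xi> - \<eta>) $ j)) * ?g (\<xi> - \<eta>))"
        proof (cases "?f \<eta> = 0 \<or> ?g (\<xi> - \<eta>) = 0")
          case False
          then have "sgn (\<xi> $ j) = sgn ((\<xi> - \<eta>) $ j)" using signs[of \<eta> "\<xi> - \<eta>"] a \<xi> by simp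
          then show ?thesis by simp
        qed auto
      qed
    qed
    finally show "of_real (sgn (\<xi> $ j)) * (LINT \<eta>|lebesgue. ?f \<eta> * ?g (\<xi> - \<eta>)) = 
       (LINT \<eta>|lebesgue. ?f \<eta> * (of_real (sgn ((\<xi> - \<eta>) $ j)) * ?g (\<xi> - \<eta>)))" .
  qed
  then show "AE x in lebesgue. partial_hilbert j (\<lambda>y. f y * g y) x = f x * partial_hilbert j g x"
    using bedrosian_fourier_iff[OF Ff _ Fg] f by blast
qed

section \<open>From the sign condition to intervals\<close>

theorem theorem1p5:
  fixes A B :: "(real^'n) set"
  assumes "A \<in> sets lebesgue" and "B \<in> sets lebesgue"
  shows "(\<forall>j::'n. bedrosian_identity (partial_hilbert j) A B) \<longleftrightarrow>
    (\<exists>a b :: 'n \<Rightarrow> ereal.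
       (\<forall>j. 0 \<le> a j \<and> 0 \<le> b j) \<and>
       ess_closure A \<subseteq> {x. \<forall>j. x $ j \<in> {t::real. - a j \<le> ereal t \<and> ereal t \<le> b j}} \<and>
       ess_closure B \<subseteq> {x. \<forall>j. x $ j \<in> UNIV - {t::real. - b j < ereal t \<and> ereal t < a j}})"
    (is "?L \<longleftrightarrow> (\<exists>a b. ?R a b)")
proof
  assume L: ?L
  note signs = bedrosian_signs[OF assms L[rule_format]]
  \<comment> \<open>Inserting 0 keeps the suprema nonnegative, also when the essential closure of
    \<open>A\<close> is empty.\<close>
  define a where "a j = Sup (insert 0 ((\<lambda>p. ereal (- (p $ j))) ` ess_closure A))" for j
  define b where "b j = Sup (insert 0 ((\<lambda>p. ereal (p $ j)) ` ess_closure A))" for j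
  have ab0: "0 \<le> a j" "0 \<le> b j" for j unfolding a_def b_def by (auto intro: Sup_upper)
  have inA: "- a j \<le> ereal (p $ j) \<and> ereal (p $ j) \<le> b j" if "p \<in> ess_closure A" for p j
  proof
    have "ereal (- (p $ j)) \<le> a j" unfolding a_def using that by (intro Sup_upper) auto
    then show "- a j \<le> ereal (p $ j)" by (subst ereal_uminus_le_reorder) simp
    show "ereal (p $ j) \<le> b j" unfolding b_def using that by (intro Sup_upper) auto
  qed
  have notB: "\<not> (- b j < ereal (q $ j) \<and> ereal (q $ j) < a j)" if q: "q \<in> ess_closure B" for q j
  proof
    assume "- b j < ereal (q $ j) \<and> ereal (q $ j) < a j"
    then have qb: "ereal (- (q $ j)) < b j" and qa: "ereal (q $ j) < a j"
      using ereal_uminus_less_reorder[of "b j" "ereal (q $ j)"] by simp_all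
    consider "q $ j > 0" | "q $ j < 0" | "q $ j = 0" by linarith
    then show False
    proof cases
      \<comment> \<open>A positive \<open>q $ j\<close> below the supremum \<open>a j\<close> is
        exceeded by some \<open>- (p $ j)\<close>, since the inserted 0 cannot exceed it; then
        \<open>p $ j + q $ j\<close> is negative.\<close>
      case 1
      then obtain p where "p \<in> ess_closure A" "q $ j < - (p $ j)" using qa unfolding a_def less_Sup_iff by auto
      then show False using signs[of p q j] q 1 by (simp add: sgn_if)
    next
      case 2
      then obtain p where "p \<in> ess_closure A" "- (q $ j) < p $ j" using qb unfolding b_def less_Sup_iff by auto
      then show False using signs[of p q j] q 2 by (simp add: sgn_if)
    next
      \<comment> \<open>The sign condition says nothing about \<open>q\<close> itself here. Points
        \<open>p\<close> and \<open>p'\<close> with components of both signs exist, and a nearby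
        point \<open>x\<close> with \<open>x $ j\<close> nonzero and smaller in modulus than both
        components contradicts the condition for one of them.\<close>
      case 3
      obtain p where p: "p \<in> ess_closure A" "p $ j < 0" using qa 3 unfolding a_def less_Sup_iff by auto
      obtain p' where p': "p' \<in> ess_closure A" "p' $ j > 0" using qb 3 unfolding b_def less_Sup_iff by auto
      define d where "d = min (- (p $ j)) (p' $ j)"
      have d: "d > 0" using p p' by (simp add: d_def)
      \<comment> \<open>\<open>B\<close> has positive measure in the ball, almost all its points lie
        in its essential closure, and the hyperplane of vanishing \<open>j\<close>-th component is a
        null set.\<close>
      have "\<exists>x \<in> ball q d. x \<in> ess_closure B \<and> x $ j \<noteq> 0"
      proof (rule ccontr)
        assume n: "\<not> (\<exists>x \<in> ball q d. x \<in> ess_closure B \<and> x $ j \<noteq> 0)"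
        have "AE x in lebesgue. x \<notin> ball q d \<inter> B"
          using AE_in_ess_closure[OF assms(2)] AE_nth_nonzero[of j] by eventually_elim (use n in blast)
        then have "emeasure lebesgue (ball q d \<inter> B) = 0"
          by (subst (asm) AE_iff_null_sets[symmetric]) (intro sets.Int assms(2) fmeasurableD lmeasurable_ball, blast)
        moreover have "emeasure lebesgue (ball q d \<inter> B) > 0" using q d by (auto simp: ess_closure_def)
        ultimately show False by simp
      qed
      then obtain x where x: "x \<in> ball q d" "x \<in> ess_closure B" "x $ j \<noteq> 0" by blast
      have "\<bar>x $ j\<bar> < d"
        using x(1) component_le_norm_cart[of "x - q" j] 3 by (simp add: dist_norm norm_minus_commute)
      then show False
        using signs[OF p(1) x(2,3)] signs[OF p'(1) x(2,3)] x(3) unfolding d_def by (auto simp: sgn_if abs_if split: if_splits)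
    qed
  qed
  have "ess_closure A \<subseteq> {x. \<forall>j. x $ j \<in> {t. - a j \<le> ereal t \<and> ereal t \<le> b j}}"
    using inA by auto
  moreover have "ess_closure B \<subseteq> {x. \<forall>j. x $ j \<in> UNIV - {t. - b j < ereal t \<and> ereal t < a j}}"
    using notB by fast
  ultimately have "?R a b" using ab0 by simp
  then show "\<exists>a b. ?R a b" by blast
next
  assume "\<exists>a b. ?R a b"
  then obtain a b where R: "?R a b" by blast
  show ?L
  proof
    fix j
    show "bedrosian_identity (partial_hilbert j) A B"
    proof (rule bedrosian_identityI[OF assms])
      fix p q assume p: "p \<in> ess_closure A" and q: "q \<in> ess_closure B" and nz: "q $ j \<noteq> 0" "p $ j + q $ j \<noteq> 0"
      have P: "- a j \<le> ereal (p $ j)" "ereal (p $ j) \<le> b j" using R p by blast+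
      have Q: "\<not> (- b j < ereal (q $ j) \<and> ereal (q $ j) < a j)" using R q by blast
      have ab: "0 \<le> a j" "0 \<le> b j" using R by blast+
      \<comment> \<open>Either \<open>q $ j \<ge> a j\<close> and \<open>p $ j \<ge> - a j\<close>,
        or \<open>q $ j \<le> - b j\<close> and \<open>p $ j \<le> b j\<close>. So
        \<open>q $ j\<close> and the sum have weakly the same sign, and strictly so since neither
        vanishes.\<close>
      show "sgn (p $ j + q $ j) = sgn (q $ j)"
        using P Q ab nz by (cases "a j"; cases "b j") (auto simp: sgn_if)
    qed
  qed
qed

end
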